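(* Let $\mathcal{L}=p+\sum_{n\ge1}u_np^{-n}$ and $\mathcal{M}=\sum_{n\ge1}nt_n\mathcal{L}^{n-1}+\sum_{n\ge1}v_n\mathcal{L}^{-n}$ satisfy the Lax-Sato equations of the generalized dKP (Manakov-Santini) hierarchy $$\frac{\partial\psi}{\partial t_n}=A_n\frac{\partial\psi}{\partial x}-B_n\frac{\partial\psi}{\partial p},\qquad \psi=\begin{pmatrix}\mathcal{L}\\ \mathcal{M}\end{pmatrix},$$ with $A_n=(J_0^{-1}\,\partial\mathcal{L}^n/\partial p)_+$, $B_n=(J_0^{-1}\,\partial\mathcal{L}^n/\partial x)_+$, where $J_0=\frac{\partial\mathcal{L}}{\partial p}\frac{\partial\mathcal{M}}{\partial x}-\frac{\partial\mathcal{L}}{\partial x}\frac{\partial\mathcal{M}}{\partial p}$. Write $y=t_2$, $t=t_3$, $u=u_1$, $v=v_1$. Then $u,v$ satisfy the Manakov-Santini equation $$\frac13u_{xt}=\frac14u_{yy}+(uu_x)_x+\frac12v_xu_{xy}-\frac12u_{xx}v_y,$$ $$\frac13v_{xt}=\frac14v_{yy}+uv_{xx}+\frac12v_xv_{xy}-\frac12v_{xx}v_y.$$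
   Context: The coefficients $u_n,v_n$ ($n\ge1$) are smooth functions of $x$ and of the times $t_1,t_2,t_3,\dots$; $p$ is a formal (spectral) variable. $\mathcal{L}$ is a formal Laurent series in $p$ (finitely many positive powers). For a Laurent series in $p$, $(\cdot)_+$ denotes the projection onto the polynomial part (non-negative powers of $p$). The sum $\sum_n nt_n\mathcal{L}^{n-1}$ in $\mathcal{M}$ is formal (one may take only finitely many nonzero $t_n$). Convention: $x$ is identified with the first time, i.e. $t_1$ and $x$ enter only through $t_1+x$ (so the first term of $\mathcal{M}$ is really $t_1+x$). Thus the derivative of $\mathcal{M}$ in $x$ with $\mathcal{L}$ held fixed is $1+\sum_{n\ge1}v_{nx}\mathcal{L}^{-n}$, the derivative in $t_m$ with $\mathcal{L}$ held fixed is $m\mathcal{L}^{m-1}+\sum_{n\ge1}v_{n t_m}\mathcal{L}^{-n}$, and full derivatives of $\mathcal{M}$ at fixed $p$ are obtained from these by the chain rule through $\mathcal{L}$. Consequently $J_0=\frac{\partial\mathcal{L}}{\partial p}\bigl(1+\sum_{n\ge1}v_{nx}\mathcal{L}^{-n}\bigr)=1+v_{1x}p^{-1}+(v_{2x}-u_1)p^{-2}+\cdots$, which is invertible as a series in $p^{-1}$. Subscripts $x,y,t$ denote partial derivatives. *)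

theory Defs
  imports "HOL-Analysis.Analysis" "HOL-Computational_Algebra.Computational_Algebra"
begin

section \<open>Functions of x and of infinitely many times\<close>

text \<open>A point is a pair \<open>(x, t)\<close> with \<open>t n\<close> the \<open>n\<close>-th time, \<open>n \<ge> 1\<close>. Only finitely many times are
  nonzero, so that the sum over the times in \<open>\<M>\<close> is finite. The index 0 is not used: \<open>t 0 = 0\<close>.\<close>

type_synonym point = "real \<times> (nat \<Rightarrow> real)"

definition slice :: "nat \<Rightarrow> point set" where
  "slice N = {(x, t). t 0 = 0 \<and> (\<forall>n>N. t n = 0)}"

text \<open>On each slice (a copy of the \<open>(N+1)\<close>-dimensional space of \<open>(x, t\<^sub>1, \<dots>, t\<^sub>N)\<close>) the product topology
  is the Euclidean one; a domain is a set of points with relatively open trace on every slice.\<close>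

definition is_domain :: "point set \<Rightarrow> bool" where
  "is_domain D \<longleftrightarrow>
     D \<subseteq> (\<Union>N. slice N) \<and> (\<forall>N. openin (top_of_set (slice N)) (D \<inter> slice N))"

definition dx :: "(point \<Rightarrow> real) \<Rightarrow> point \<Rightarrow> real" where
  "dx f = (\<lambda>(x, t). deriv (\<lambda>s. f (s, t)) x)"

definition dt :: "nat \<Rightarrow> (point \<Rightarrow> real) \<Rightarrow> point \<Rightarrow> real" where
  "dt m f = (\<lambda>(x, t). deriv (\<lambda>s. f (x, t(m := s))) (t m))"

text \<open>Smoothness: all iterated partial derivatives exist, and each of them is jointly continuous in
  any finite number of the variables.\<close>

coinductive smooth_on :: "point set \<Rightarrow> (point \<Rightarrow> real) \<Rightarrow> bool" for D where
  "\<lbrakk> \<And>N. continuous_on (D \<inter> slice N) f;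
     \<And>x t. (x, t) \<in> D \<Longrightarrow> (\<lambda>s. f (s, t)) differentiable (at x);
     \<And>m x t. m \<ge> 1 \<Longrightarrow> (x, t) \<in> D \<Longrightarrow> (\<lambda>s. f (x, t(m := s))) differentiable (at (t m));
     smooth_on D (dx f);
     \<And>m. m \<ge> 1 \<Longrightarrow> smooth_on D (dt m f) \<rbrakk> \<Longrightarrow> smooth_on D f"

text \<open>The convention identifying \<open>x\<close> with the first time.\<close>

definition via_t1_plus_x :: "point set \<Rightarrow> (point \<Rightarrow> real) \<Rightarrow> bool" where
  "via_t1_plus_x D f \<longleftrightarrow>
     (\<forall>x t x' t'. (x, t) \<in> D \<and> (x', t') \<in> D \<and> t 1 + x = t' 1 + x' \<and> (\<forall>n. n \<noteq> 1 \<longrightarrow> t n = t' n)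
        \<longrightarrow> f (x, t) = f (x', t'))"


section \<open>Laurent series in p\<close>

text \<open>A series with finitely many positive powers of \<open>p\<close> is a formal Laurent series in \<open>X = 1/p\<close>: the
  coefficient of \<open>p\<^sup>k\<close> in \<open>F\<close> is \<open>fls_nth F (- k)\<close>, and \<open>p\<close> itself is \<open>fls_X_inv\<close>.\<close>

text \<open>From \<open>d/dp = - X\<^sup>2 d/dX\<close>.\<close>

definition dp :: "real fls \<Rightarrow> real fls" where
  "dp F = - (fls_X ^ 2 * fls_deriv F)"

definition poly_part :: "real fls \<Rightarrow> real fls" where
  "poly_part F = Abs_fls (\<lambda>k. if k \<le> 0 then fls_nth F k else 0)"

text \<open>Partial derivatives at fixed \<open>p\<close> act on each coefficient.\<close>

definition Dx :: "(point \<Rightarrow> real fls) \<Rightarrow> point \<Rightarrow> real fls" where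
  "Dx F q = Abs_fls (\<lambda>k. dx (\<lambda>q'. fls_nth (F q') k) q)"

definition Dt :: "nat \<Rightarrow> (point \<Rightarrow> real fls) \<Rightarrow> point \<Rightarrow> real fls" where
  "Dt m F q = Abs_fls (\<lambda>k. dt m (\<lambda>q'. fls_nth (F q') k) q)"


section \<open>The Lax-Sato equations\<close>

text \<open>The sum over \<open>n \<ge> 1\<close> of \<open>a n * W\<^sup>n\<close>, for \<open>W\<close> a series in negative powers of \<open>p\<close> only.\<close>

definition series_in :: "(nat \<Rightarrow> real) \<Rightarrow> real fls \<Rightarrow> real fls" where
  "series_in a W = fps_to_fls (fps_compose (Abs_fps (\<lambda>n. if n = 0 then 0 else a n)) (fls_regpart W))"

lemma fls_nth_series_in:
  assumes "fls_subdegree W \<ge> 1"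
  shows "fls_nth (series_in a W) k = (\<Sum>n=1..nat k. a n * fls_nth (W ^ n) k)"
proof -
  have W: "fps_to_fls (fls_regpart W) = W"
    using assms by simp
  then have pow: "fls_nth (W ^ n) (int j) = fps_nth (fls_regpart W ^ n) j" for n j
  proof -
    have "W ^ n = fps_to_fls (fls_regpart W ^ n)"
      by (simp only: fps_to_fls_power W)
    then show ?thesis by simp
  qed
  show ?thesis
  proof (cases "k < 0")
    case True
    then show ?thesis by (simp add: series_in_def)
  next
    case False
    then obtain j where k: "k = int j" by (metis nonneg_int_cases not_less)
    have "fls_nth (series_in a W) k
        = (\<Sum>n=0..j. (if n = 0 then 0 else a n) * fps_nth (fls_regpart W ^ n) j)"
      by (simp add: series_in_def k fps_compose_nth)
    also have "\<dots> = (\<Sum>n=1..j. a n * fps_nth (fls_regpart W ^ n) j)"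
      by (rule sum.mono_neutral_cong_right) auto
    finally show ?thesis by (simp add: k pow)
  qed
qed

definition Lax :: "(nat \<Rightarrow> point \<Rightarrow> real) \<Rightarrow> point \<Rightarrow> real fls" where
  "Lax u q = fls_X_inv + series_in (\<lambda>n. u n q) fls_X"

definition Orlov ::
  "(nat \<Rightarrow> point \<Rightarrow> real) \<Rightarrow> (nat \<Rightarrow> point \<Rightarrow> real) \<Rightarrow> point \<Rightarrow> real fls" where
  "Orlov u v = (\<lambda>(x, t).
     fls_const x
     + (\<Sum>n | n \<ge> 1 \<and> t n \<noteq> 0. fls_const (of_nat n * t n) * Lax u (x, t) ^ (n - 1))
     + series_in (\<lambda>n. v n (x, t)) (inverse (Lax u (x, t))))"

definition J0 ::
  "(point \<Rightarrow> real fls) \<Rightarrow> (point \<Rightarrow> real fls) \<Rightarrow> point \<Rightarrow> real fls" where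
  "J0 L M q = dp (L q) * Dx M q - Dx L q * dp (M q)"

definition A_coeff ::
  "(point \<Rightarrow> real fls) \<Rightarrow> (point \<Rightarrow> real fls) \<Rightarrow> nat \<Rightarrow> point \<Rightarrow> real fls" where
  "A_coeff L M n q = poly_part (inverse (J0 L M q) * dp (L q ^ n))"

definition B_coeff ::
  "(point \<Rightarrow> real fls) \<Rightarrow> (point \<Rightarrow> real fls) \<Rightarrow> nat \<Rightarrow> point \<Rightarrow> real fls" where
  "B_coeff L M n q = poly_part (inverse (J0 L M q) * Dx (\<lambda>q'. L q' ^ n) q)"

definition Lax_Sato ::
  "point set \<Rightarrow> (point \<Rightarrow> real fls) \<Rightarrow> (point \<Rightarrow> real fls) \<Rightarrow> bool" where
  "Lax_Sato D L M \<longleftrightarrow>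
     (\<forall>n\<ge>1. \<forall>q\<in>D. \<forall>\<psi>\<in>{L, M}.
        Dt n \<psi> q = A_coeff L M n q * Dx \<psi> q - B_coeff L M n q * dp (\<psi> q))"

end

theory Submission
  imports Defs
begin

text \<open>With \<open>\<L>\<close> held fixed, \<open>\<M>\<close> has the \<open>x\<close>-derivative \<open>H = 1 + \<Sum> v\<^sub>n\<^sub>x \<L>\<^sup>-\<^sup>n\<close>. The chain rule gives
  \<open>J\<^sub>0 = \<L>\<^sub>p H\<close>, hence \<open>A\<^sub>n = (n \<L>\<^sup>n\<^sup>-\<^sup>1 / H)\<^sub>+\<close> and \<open>B\<^sub>n = (n \<L>\<^sup>n\<^sup>-\<^sup>1 \<L>\<^sub>x / (\<L>\<^sub>p H))\<^sub>+\<close>, and reduces the equation for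
  \<open>\<M>\<close>, modulo the one for \<open>\<L>\<close>, to \<open>m \<L>\<^sup>m\<^sup>-\<^sup>1 + \<Sum> v\<^sub>n\<^sub>t \<L>\<^sup>-\<^sup>n = A\<^sub>m H\<close>. The coefficients of \<open>p\<^sup>-\<^sup>1, p\<^sup>-\<^sup>2\<close> for
  \<open>t\<^sub>2\<close> and of \<open>p\<^sup>-\<^sup>1\<close> for \<open>t\<^sub>3\<close> are first-order equations for \<open>u\<^sub>1, u\<^sub>2, u\<^sub>3, v\<^sub>1, v\<^sub>2, v\<^sub>3\<close>. Eliminating
  \<open>u\<^sub>3, v\<^sub>3\<close> at once, then \<open>u\<^sub>2, v\<^sub>2\<close> by differentiating once more and commuting the partial
  derivatives, leaves the Manakov-Santini system.\<close>

unbundle fps_syntax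

subsection \<open>Order and product of Laurent series\<close>

text \<open>A lower bound on the order in \<open>X = 1/p\<close>. Unlike a bound on
  \<open>fls_subdegree\<close>, which is 0 at the zero series by convention, it holds for the zero
  series at every \<open>N\<close>, so sums and products need no case distinction.\<close>

definition vanishes_below :: "int \<Rightarrow> real fls \<Rightarrow> bool" where
  "vanishes_below N f \<longleftrightarrow> (\<forall>k<N. f $$ k = 0)"

lemma vanishes_below_nth: "vanishes_below N f \<Longrightarrow> k < N \<Longrightarrow> f $$ k = 0"
  by (simp add: vanishes_below_def)

lemma vanishes_below_mono: "vanishes_below N f \<Longrightarrow> M \<le> N \<Longrightarrow> vanishes_below M f"
  by (simp add: vanishes_below_def)

lemma fls_subdegree_ge_if_vanishes_below: "vanishes_below N f \<Longrightarrow> f \<noteq> 0 \<Longrightarrow> N \<le> fls_subdegree f"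
  by (rule fls_subdegree_geI) (auto simp: vanishes_below_def)

lemma vanishes_below_ex: "\<exists>N. vanishes_below N f"
  unfolding vanishes_below_def by (meson fls_nth_vanishes_belowE)

text \<open>The range of summation depends on the bounds \<open>a\<close> and \<open>b\<close>
  alone, not on the actual orders of the factors, so it stays fixed while the factors move along a
  curve.\<close>

lemma fls_times_nth_vanishes_below:
  assumes "vanishes_below a f" "vanishes_below b g"
  shows "(f * g) $$ k = (\<Sum>i=a..k-b. f $$ i * g $$ (k - i))"
proof (cases "f = 0 \<or> g = 0")
  case False
  then have "a \<le> fls_subdegree f" "b \<le> fls_subdegree g"
    using assms by (auto intro: fls_subdegree_ge_if_vanishes_below)
  then show ?thesis
    unfolding fls_times_nth(2) by (intro sum.mono_neutral_left) auto
qed auto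

lemma vanishes_below_mult:
  assumes "vanishes_below a f" "vanishes_below b g"
  shows "vanishes_below (a + b) (f * g)"
  unfolding vanishes_below_def by (auto simp: fls_times_nth_vanishes_below[OF assms])

lemma vanishes_below_add:
  "vanishes_below a f \<Longrightarrow> vanishes_below a g \<Longrightarrow> vanishes_below a (f + g)"
  by (simp add: vanishes_below_def)

lemma vanishes_below_const [simp]: "vanishes_below 0 (fls_const c)"
  by (simp add: vanishes_below_def)

lemma vanishes_below_1 [simp]: "vanishes_below 0 1"
  by (simp add: vanishes_below_def)

lemma vanishes_below_power:
  "vanishes_below a f \<Longrightarrow> vanishes_below (int n * a) (f ^ n)"
proof (induction n)
  case (Suc n)
  then show ?case
    using vanishes_below_mult[of a f "int n * a" "f ^ n"] by (simp add: algebra_simps)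
qed simp

text \<open>A nonzero coefficient at \<open>d\<close> makes the order of \<open>f\<close> exactly
  \<open>d\<close>, and inversion negates the order.\<close>

lemma vanishes_below_inverse:
  assumes "vanishes_below d f" "f $$ d \<noteq> 0"
  shows "vanishes_below (- d) (inverse f)"
proof -
  have "f \<noteq> 0" using assms(2) by auto
  then have "fls_subdegree f = d"
    using assms by (intro antisym fls_subdegree_leI fls_subdegree_ge_if_vanishes_below) auto
  then show ?thesis
    by (auto simp: vanishes_below_def)
qed

text \<open>Counting from the lowest possible order \<open>a + b\<close> turns the coefficients into
  sums over naturals, suited to recursion and to explicit expansion.\<close>

lemma fls_times_nth_add:
  assumes "vanishes_below a f" "vanishes_below b g"
  shows "(f * g) $$ (a + b + int n) = (\<Sum>i\<le>n. f $$ (a + int i) * g $$ (b + int (n - i)))"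
proof -
  have "(f * g) $$ (a + b + int n) = (\<Sum>i=a..a + int n. f $$ i * g $$ (a + b + int n - i))"
    by (simp add: fls_times_nth_vanishes_below[OF assms])
  also have "\<dots> = (\<Sum>i\<le>n. f $$ (a + int i) * g $$ (b + int (n - i)))"
    by (rule sum.reindex_bij_witness[where i="\<lambda>i. a + int i" and j="\<lambda>j. nat (j - a)"])
       (auto simp: of_nat_diff algebra_simps)
  finally show ?thesis .
qed

text \<open>\<open>f - g\<close> has order above \<open>k - b\<close>, so its product with
  \<open>h\<close> has order above \<open>k\<close>. This lets a truncation replace a series inside
  a product.\<close>

lemma fls_times_nth_cong_below:
  assumes h: "vanishes_below b h" and eq: "\<And>j. j \<le> k - b \<Longrightarrow> f $$ j = g $$ j"
  shows "(f * h) $$ k = (g * h) $$ k"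
proof -
  have "vanishes_below (k - b + 1) (f - g)"
    by (simp add: vanishes_below_def eq)
  from vanishes_below_mult[OF this h] have "((f - g) * h) $$ k = 0"
    by (simp add: vanishes_below_def)
  then show ?thesis
    by (simp add: algebra_simps)
qed

subsection \<open>Coefficientwise derivatives along a curve\<close>

text \<open>The lower bound uniform in \<open>s\<close> turns every coefficient of a product into a fixed finite sum.\<close>

definition has_coeff_deriv :: "(real \<Rightarrow> real fls) \<Rightarrow> real fls \<Rightarrow> real \<Rightarrow> bool" where
  "has_coeff_deriv F F' s0 \<longleftrightarrow>
     (\<exists>N. \<forall>s. vanishes_below N (F s)) \<and>
     (\<forall>k. ((\<lambda>s. F s $$ k) has_real_derivative F' $$ k) (at s0))"

lemma has_coeff_deriv_vanishes_below:
  assumes "has_coeff_deriv F F' s0" "\<And>s. vanishes_below N (F s)"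
  shows "vanishes_below N F'"
  unfolding vanishes_below_def
proof (intro allI impI)
  fix k assume "k < N"
  then have "(\<lambda>s. F s $$ k) = (\<lambda>s. 0)"
    using assms(2) by (auto simp: vanishes_below_def)
  then have "((\<lambda>s. 0) has_real_derivative F' $$ k) (at s0)"
    using assms(1) unfolding has_coeff_deriv_def by metis
  then show "F' $$ k = 0"
    using DERIV_unique DERIV_const by blast
qed

lemma has_coeff_deriv_unique:
  assumes "has_coeff_deriv F A s0" "has_coeff_deriv F B s0"
  shows "A = B"
  using assms unfolding has_coeff_deriv_def by (intro fls_eqI) (meson DERIV_unique)

lemma has_coeff_deriv_const: "has_coeff_deriv (\<lambda>s. f) 0 s0"
  using vanishes_below_ex by (auto simp: has_coeff_deriv_def)

lemma has_coeff_deriv_fls_const: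
  "(c has_real_derivative c') (at s0) \<Longrightarrow> has_coeff_deriv (\<lambda>s. fls_const (c s)) (fls_const c') s0"
  unfolding has_coeff_deriv_def
  by (intro conjI exI[of _ 0] allI vanishes_below_const) (auto simp: fls_const_nth)

lemma has_coeff_deriv_add:
  assumes "has_coeff_deriv F F' s0" "has_coeff_deriv G G' s0"
  shows "has_coeff_deriv (\<lambda>s. F s + G s) (F' + G') s0"
proof -
  obtain M N where "\<And>s. vanishes_below M (F s)" "\<And>s. vanishes_below N (G s)"
    using assms by (auto simp: has_coeff_deriv_def)
  then have "\<And>s. vanishes_below (min M N) (F s + G s)"
    by (meson vanishes_below_add vanishes_below_mono min.cobounded1 min.cobounded2)
  then show ?thesis
    using assms by (auto simp: has_coeff_deriv_def intro!: DERIV_add)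
qed

lemma has_coeff_deriv_mult:
  assumes F: "has_coeff_deriv F F' s0" and G: "has_coeff_deriv G G' s0"
  shows "has_coeff_deriv (\<lambda>s. F s * G s) (F' * G s0 + F s0 * G') s0"
proof -
  obtain M where M: "\<And>s. vanishes_below M (F s)"
    using F by (auto simp: has_coeff_deriv_def)
  obtain N where N: "\<And>s. vanishes_below N (G s)"
    using G by (auto simp: has_coeff_deriv_def)
  note M' = has_coeff_deriv_vanishes_below[OF F M]
  note N' = has_coeff_deriv_vanishes_below[OF G N]
  have "((\<lambda>s. \<Sum>i=M..k-N. F s $$ i * G s $$ (k - i)) has_real_derivative
      (\<Sum>i=M..k-N. F' $$ i * G s0 $$ (k - i) + F s0 $$ i * G' $$ (k - i))) (at s0)" for k
    using F G unfolding has_coeff_deriv_def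
    by (intro DERIV_sum) (auto intro!: derivative_eq_intros)
  then have "((\<lambda>s. (F s * G s) $$ k) has_real_derivative (F' * G s0 + F s0 * G') $$ k) (at s0)" for k
    by (simp add: fls_times_nth_vanishes_below[OF M N] fls_times_nth_vanishes_below[OF M' N]
        fls_times_nth_vanishes_below[OF M N'] sum.distrib)
  then show ?thesis
    using vanishes_below_mult[OF M N] by (auto simp: has_coeff_deriv_def)
qed

lemma has_coeff_deriv_power:
  assumes "has_coeff_deriv F F' s0"
  shows "has_coeff_deriv (\<lambda>s. F s ^ n) (of_nat n * F s0 ^ (n - 1) * F') s0"
proof (induction n)
  case 0
  show ?case using has_coeff_deriv_const[of 1] by simp
next
  case (Suc n)
  have "F' * F s0 ^ n + F s0 * (of_nat n * F s0 ^ (n - 1) * F') = of_nat (Suc n) * F s0 ^ n * F'"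
    by (cases n) (simp_all add: algebra_simps)
  then show ?case
    using has_coeff_deriv_mult[OF assms Suc] by simp
qed

lemma has_coeff_deriv_sum:
  assumes "finite S" "\<And>i. i \<in> S \<Longrightarrow> has_coeff_deriv (F i) (F' i) s0"
  shows "has_coeff_deriv (\<lambda>s. \<Sum>i\<in>S. F i s) (\<Sum>i\<in>S. F' i) s0"
  using assms
  by (induction S rule: finite_induct) (auto intro: has_coeff_deriv_const has_coeff_deriv_add)

text \<open>The identity \<open>F * G = 1\<close> determines the coefficients of the inverse
  recursively, dividing only by the lowest coefficient of \<open>F\<close>, so differentiability
  follows by induction. Differentiating the same identity then yields the formula.\<close>

lemma has_coeff_deriv_inverse:
  assumes F: "has_coeff_deriv F F' s0"
    and d: "\<And>s. vanishes_below d (F s)" "\<And>s. F s $$ d \<noteq> 0"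
  shows "has_coeff_deriv (\<lambda>s. inverse (F s)) (- (inverse (F s0) ^ 2 * F')) s0"
proof -
  define G where "G s = inverse (F s)" for s
  have G: "vanishes_below (- d) (G s)" and FG: "F s * G s = 1" for s
    using vanishes_below_inverse[OF d] d(2)[of s] by (auto simp: G_def intro!: right_inverse)
  have rec: "G s $$ (int j - d) =
      ((if j = 0 then 1 else 0) - (\<Sum>i=1..j. F s $$ (d + int i) * G s $$ (int (j - i) - d))) / F s $$ d"
    for s j
  proof -
    have "(if j = 0 then 1 else 0) = (F s * G s) $$ (d + - d + int j)"
      by (simp add: FG)
    also have "\<dots> = (\<Sum>i\<le>j. F s $$ (d + int i) * G s $$ (int (j - i) - d))"
      unfolding fls_times_nth_add[OF d(1) G] by (simp add: algebra_simps)
    also have "\<dots> = F s $$ d * G s $$ (int j - d)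
        + (\<Sum>i=1..j. F s $$ (d + int i) * G s $$ (int (j - i) - d))"
      by (subst atMost_atLeast0, subst sum.atLeast_Suc_atMost) auto
    finally show ?thesis using d(2)[of s] by (simp add: field_simps)
  qed
  have Fk: "(\<lambda>s. F s $$ k) differentiable (at s0)" for k
    using F by (auto simp: has_coeff_deriv_def real_differentiable_def)
  have diff: "(\<lambda>s. G s $$ (int j - d)) differentiable (at s0)" for j
  proof (induction j rule: less_induct)
    case (less j)
    have "(\<lambda>s. F s $$ (d + int i) * G s $$ (int (j - i) - d)) differentiable (at s0)"
      if "i \<in> {1..j}" for i
      using that by (intro differentiable_mult Fk less) auto
    then have "(\<lambda>s. ((if j = 0 then 1 else 0)
        - (\<Sum>i=1..j. F s $$ (d + int i) * G s $$ (int (j - i) - d))) / F s $$ d)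
        differentiable (at s0)"
      using d(2) by (intro differentiable_divide differentiable_diff differentiable_sum Fk) auto
    then show ?case
      by (subst rec)
  qed
  define G' where "G' = Abs_fls (\<lambda>k. deriv (\<lambda>s. G s $$ k) s0)"
  \<comment> \<open>\<open>Abs_fls\<close> has the intended coefficients only if they vanish far
    enough down; below \<open>- d\<close> the functions are constantly 0, hence so are their
    derivatives.\<close>
  have below: "(\<lambda>s. G s $$ k) = (\<lambda>s. 0)" if "k < - d" for k
    using G that by (auto simp: vanishes_below_def)
  have "G' $$ k = deriv (\<lambda>s. G s $$ k) s0" for k
    unfolding G'_def by (rule nth_Abs_fls_lower_bound[of "- d"]) (auto simp: below)
  moreover have "(\<lambda>s. G s $$ k) differentiable (at s0)" for k
    using diff[of "nat (k + d)"] below[of k] by (cases "k < - d") auto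
  ultimately have G': "has_coeff_deriv G G' s0"
    using G by (auto simp: has_coeff_deriv_def DERIV_deriv_iff_real_differentiable)
  \<comment> \<open>The product rule and the constancy of 1 give two derivatives of the same
    curve.\<close>
  have "F' * G s0 + F s0 * G' = 0"
    using has_coeff_deriv_mult[OF F G'] has_coeff_deriv_const[of 1 s0]
    by (intro has_coeff_deriv_unique[of "\<lambda>s. F s * G s"]) (simp_all add: FG)
  then have "G s0 * (F' * G s0 + F s0 * G') = 0"
    by simp
  moreover have "G s0 * (F' * G s0 + F s0 * G') = G s0 ^ 2 * F' + (F s0 * G s0) * G'"
    by (simp add: algebra_simps power2_eq_square)
  ultimately have "G' = - (G s0 ^ 2 * F')"
    unfolding FG by (simp add: eq_neg_iff_add_eq_0 add.commute)
  then show ?thesis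
    using G' by (simp add: G_def[abs_def])
qed

subsection \<open>Chain rule for series in a variable series\<close>

text \<open>The formal derivative in \<open>W\<close>, with terms
  \<open>n * a n * W ^ (n - 1)\<close>. The term \<open>n = 1\<close> stands apart because
  \<open>series_in\<close> ignores index 0.\<close>

definition series_in_deriv :: "(nat \<Rightarrow> real) \<Rightarrow> real fls \<Rightarrow> real fls" where
  "series_in_deriv a W = fls_const (a 1) + series_in (\<lambda>n. of_nat (n + 1) * a (n + 1)) W"

lemma fls_nth_series_in_vanishes_below:
  assumes "vanishes_below 1 W"
  shows "series_in a W $$ k = (\<Sum>n=1..nat k. a n * (W ^ n) $$ k)"
proof (cases "W = 0")
  case True
  have "fls_regpart W = 0" using True by simp
  then show ?thesis
    using True by (simp add: series_in_def fps_compose_0_right power_0_left)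
next
  case False
  then show ?thesis
    using assms by (intro fls_nth_series_in fls_subdegree_ge_if_vanishes_below)
qed

text \<open>\<open>W ^ n\<close> has order at least \<open>n\<close>, so the terms beyond
  \<open>K\<close> do not reach coefficient \<open>k\<close>.\<close>

lemma series_in_truncate:
  assumes "vanishes_below 1 W" "k \<le> int K"
  shows "series_in a W $$ k = (\<Sum>n=1..K. fls_const (a n) * W ^ n) $$ k"
proof -
  have "(W ^ n) $$ k = 0" if "k < int n" for n
    using vanishes_below_power[OF assms(1), of n] that by (simp add: vanishes_below_def)
  then have "(\<Sum>n=1..nat k. a n * (W ^ n) $$ k) = (\<Sum>n=1..K. a n * (W ^ n) $$ k)"
    using assms(2) by (intro sum.mono_neutral_left) auto
  then show ?thesis
    by (simp add: fls_nth_series_in_vanishes_below[OF assms(1)] fls_nth_sum)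
qed

lemma vanishes_below_series_in: "vanishes_below 1 W \<Longrightarrow> vanishes_below 1 (series_in a W)"
  by (auto simp: vanishes_below_def[of _ "series_in a W"] fls_nth_series_in_vanishes_below)

lemma vanishes_below_series_in_deriv:
  "vanishes_below 1 W \<Longrightarrow> vanishes_below 0 (series_in_deriv a W)"
  unfolding series_in_deriv_def
  by (intro vanishes_below_add vanishes_below_const)
     (erule vanishes_below_mono[OF vanishes_below_series_in], simp)

text \<open>Here the powers are \<open>W ^ (n - 1)\<close>, of order one less than
  \<open>W ^ n\<close>; hence the strict bound on \<open>k\<close>.\<close>

lemma series_in_deriv_truncate:
  assumes "vanishes_below 1 W" "k < int K"
  shows "series_in_deriv a W $$ k = (\<Sum>n=1..K. fls_const (a n) * (of_nat n * W ^ (n - 1))) $$ k"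
proof (cases K)
  case 0
  then show ?thesis
    using assms vanishes_below_series_in_deriv[OF assms(1)] by (auto simp: vanishes_below_def)
next
  case (Suc J)
  have shift: "(\<Sum>n=1..Suc J. f n) = f 1 + (\<Sum>n=1..J. f (n + 1))" for f :: "nat \<Rightarrow> real fls"
    by (induction J) (simp_all add: add.assoc)
  have "fls_const (a (n + 1)) * of_nat (n + 1) = fls_const (of_nat (n + 1) * a (n + 1))" for n
    by (simp only: fls_of_nat fls_const_mult_const mult.commute)
  then have term_eq: "fls_const (a (n + 1)) * (of_nat (n + 1) * W ^ (n + 1 - 1))
      = fls_const (of_nat (n + 1) * a (n + 1)) * W ^ n" for n
    by (simp only: add_diff_cancel_right' mult.assoc[symmetric])
  have "(\<Sum>n=1..K. fls_const (a n) * (of_nat n * W ^ (n - 1)))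
      = fls_const (a 1) + (\<Sum>n=1..J. fls_const (of_nat (n + 1) * a (n + 1)) * W ^ n)"
    unfolding Suc shift term_eq by simp
  then show ?thesis
    using series_in_truncate[OF assms(1), of k J "\<lambda>n. of_nat (n + 1) * a (n + 1)"] assms(2) Suc
    by (simp add: series_in_deriv_def)
qed

text \<open>Each coefficient is that of a polynomial in \<open>W\<close> whose degree does not
  depend on \<open>s\<close>, so the rules for finite sums and products suffice. The two summands
  come from the moving coefficients and from the moving argument.\<close>

lemma has_coeff_deriv_series_in:
  assumes a: "\<And>n. n \<ge> 1 \<Longrightarrow> (a n has_real_derivative a' n) (at s0)"
    and W: "has_coeff_deriv W W' s0" "\<And>s. vanishes_below 1 (W s)"
  shows "has_coeff_deriv (\<lambda>s. series_in (\<lambda>n. a n s) (W s))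
    (series_in a' (W s0) + series_in_deriv (\<lambda>n. a n s0) (W s0) * W') s0"
  unfolding has_coeff_deriv_def
proof (intro conjI exI allI)
  show "vanishes_below 1 (series_in (\<lambda>n. a n s) (W s))" for s
    by (rule vanishes_below_series_in[OF W(2)])
next
  fix k
  define K where "K = nat k"
  have k: "k \<le> int K" by (simp add: K_def)
  have W': "vanishes_below 1 W'"
    by (rule has_coeff_deriv_vanishes_below[OF W])
  let ?S = "\<Sum>n=1..K. fls_const (a n s0) * (of_nat n * W s0 ^ (n - 1))"
  have "has_coeff_deriv (\<lambda>s. \<Sum>n=1..K. fls_const (a n s) * W s ^ n)
      (\<Sum>n=1..K. fls_const (a' n) * W s0 ^ n
        + fls_const (a n s0) * (of_nat n * W s0 ^ (n - 1) * W')) s0"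
    by (intro has_coeff_deriv_sum has_coeff_deriv_mult has_coeff_deriv_fls_const
        has_coeff_deriv_power a W(1)) auto
  moreover have "(\<Sum>n=1..K. fls_const (a' n) * W s0 ^ n
        + fls_const (a n s0) * (of_nat n * W s0 ^ (n - 1) * W'))
      = (\<Sum>n=1..K. fls_const (a' n) * W s0 ^ n) + ?S * W'"
    by (simp only: sum.distrib sum_distrib_right mult.assoc)
  ultimately have "((\<lambda>s. (\<Sum>n=1..K. fls_const (a n s) * W s ^ n) $$ k) has_real_derivative
      ((\<Sum>n=1..K. fls_const (a' n) * W s0 ^ n) $$ k + (?S * W') $$ k)) (at s0)"
    by (simp add: has_coeff_deriv_def)
  \<comment> \<open>\<open>W'\<close> has order at least 1, so only coefficients below
    \<open>k\<close> of the other factor enter.\<close>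
  moreover have "(?S * W') $$ k = (series_in_deriv (\<lambda>n. a n s0) (W s0) * W') $$ k"
    by (rule fls_times_nth_cong_below[OF W']) (rule series_in_deriv_truncate[symmetric], use k W(2) in auto)
  ultimately show "((\<lambda>s. series_in (\<lambda>n. a n s) (W s) $$ k) has_real_derivative
      (series_in a' (W s0) + series_in_deriv (\<lambda>n. a n s0) (W s0) * W') $$ k) (at s0)"
    by (simp add: series_in_truncate[OF W(2) k])
qed

lemma fls_deriv_series_in:
  assumes W: "vanishes_below 1 W"
  shows "fls_deriv (series_in a W) = series_in_deriv a W * fls_deriv W"
proof (rule fls_eqI)
  fix k
  \<comment> \<open>Coefficient \<open>k\<close> of \<open>fls_deriv\<close> comes from coefficient
    \<open>k + 1\<close>, so one more term is kept.\<close>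
  define K where "K = nat (k + 1)"
  have k: "k + 1 \<le> int K" by (simp add: K_def)
  have W': "vanishes_below 0 (fls_deriv W)"
    using W by (simp add: vanishes_below_def)
  let ?S = "\<Sum>n=1..K. fls_const (a n) * (of_nat n * W ^ (n - 1))"
  have "fls_deriv (series_in a W) $$ k = fls_deriv (\<Sum>n=1..K. fls_const (a n) * W ^ n) $$ k"
    by (simp add: series_in_truncate[OF W k])
  also have "fls_deriv (\<Sum>n=1..K. fls_const (a n) * W ^ n) = ?S * fls_deriv W"
    by (simp add: fls_deriv_sum fls_deriv_power sum_distrib_right mult.assoc)
  also have "(?S * fls_deriv W) $$ k = (series_in_deriv a W * fls_deriv W) $$ k"
    by (rule fls_times_nth_cong_below[OF W']) (rule series_in_deriv_truncate[symmetric], use k W in auto)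
  finally show "fls_deriv (series_in a W) $$ k = (series_in_deriv a W * fls_deriv W) $$ k" .
qed

subsection \<open>The Lax and Orlov series\<close>

lemma Lax_nth:
  "Lax u q $$ k = (if k = -1 then 1 else if k \<ge> 1 then u (nat k) q else 0)"
proof -
  have X: "vanishes_below 1 (fls_X :: real fls)" by (simp add: vanishes_below_def)
  have "(\<Sum>n=1..nat k. u n q * (fls_X ^ n) $$ k) = (if k \<ge> 1 then u (nat k) q else 0)"
  proof (cases "k \<ge> 1")
    case True
    have "(\<Sum>n=1..nat k. u n q * (fls_X ^ n) $$ k)
        = (\<Sum>n=1..nat k. if n = nat k then u n q else 0)"
      using True by (intro sum.cong) (auto simp: fls_X_power_nth)
    then show ?thesis using True by auto
  qed auto
  then show ?thesis
    by (auto simp: Lax_def fls_nth_series_in_vanishes_below[OF X] fls_X_inv_nth)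
qed

lemma vanishes_below_Lax: "vanishes_below (-1) (Lax u q)"
  by (simp add: vanishes_below_def Lax_nth)

lemma Lax_nz [simp]: "Lax u q \<noteq> 0"
proof
  assume "Lax u q = 0"
  moreover have "Lax u q $$ (-1) = 1" by (simp add: Lax_nth)
  ultimately show False by simp
qed

lemma vanishes_below_inverse_Lax: "vanishes_below 1 (inverse (Lax u q))"
  using vanishes_below_inverse[OF vanishes_below_Lax, of u q] by (simp add: Lax_nth)

section \<open>Differentiation in \<open>p\<close> and the chain rule through the Lax series\<close>

lemma dp_mult: "dp (f * g) = dp f * g + f * dp g"
  by (simp add: dp_def algebra_simps)

lemma dp_add: "dp (f + g) = dp f + dp g"
  by (simp add: dp_def algebra_simps)

lemma dp_const: "dp (fls_const c) = 0"
  by (simp add: dp_def)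

lemma dp_const_mult: "dp (fls_const c * f) = fls_const c * dp f"
  by (simp add: dp_mult dp_const)

lemma dp_sum: "dp (\<Sum>i\<in>S. f i) = (\<Sum>i\<in>S. dp (f i))"
  by (simp add: dp_def fls_deriv_sum sum_distrib_left sum_negf)

lemma dp_power: "dp (f ^ n) = of_nat n * f ^ (n - 1) * dp f"
  by (simp add: dp_def fls_deriv_power algebra_simps)

lemma dp_inverse_Lax: "dp (inverse (Lax u q)) = - (inverse (Lax u q) ^ 2 * dp (Lax u q))"
proof -
  have "dp (Lax u q) * inverse (Lax u q) + Lax u q * dp (inverse (Lax u q))
      = dp (Lax u q * inverse (Lax u q))"
    by (simp only: dp_mult)
  also have "\<dots> = 0"
    by (simp add: dp_def)
  finally have "dp (Lax u q) * inverse (Lax u q) + Lax u q * dp (inverse (Lax u q)) = 0" .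
  then show ?thesis
    by (simp add: field_simps power2_eq_square eq_neg_iff_add_eq_0)
qed

lemma dp_series_in: "vanishes_below 1 W \<Longrightarrow> dp (series_in a W) = series_in_deriv a W * dp W"
  by (simp add: dp_def fls_deriv_series_in)

lemma has_coeff_deriv_Lax:
  assumes "\<And>n. n \<ge> 1 \<Longrightarrow> ((\<lambda>s. u n (\<gamma> s)) has_real_derivative u' n) (at s0)"
  shows "has_coeff_deriv (\<lambda>s. Lax u (\<gamma> s)) (series_in u' fls_X) s0"
proof -
  have X: "vanishes_below 1 (fls_X :: real fls)" by (simp add: vanishes_below_def)
  have "has_coeff_deriv (\<lambda>s. series_in (\<lambda>n. u n (\<gamma> s)) fls_X)
      (series_in u' fls_X + series_in_deriv (\<lambda>n. u n (\<gamma> s0)) fls_X * 0) s0"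
    by (rule has_coeff_deriv_series_in[OF assms has_coeff_deriv_const X])
  from has_coeff_deriv_add[OF has_coeff_deriv_const this] show ?thesis
    by (simp add: Lax_def)
qed

text \<open>The derivative of \<open>\<M>\<close> with respect to \<open>\<L>\<close>, with \<open>x\<close>, the times and the \<open>v\<^sub>n\<close> held fixed.\<close>

definition Orlov_deriv_Lax ::
  "(nat \<Rightarrow> point \<Rightarrow> real) \<Rightarrow> (nat \<Rightarrow> point \<Rightarrow> real) \<Rightarrow> point \<Rightarrow> real fls" where
  "Orlov_deriv_Lax u v = (\<lambda>(x, t).
     (\<Sum>n | n \<ge> 1 \<and> t n \<noteq> 0.
        fls_const (of_nat n * t n) * (of_nat (n - 1) * Lax u (x, t) ^ (n - 1 - 1)))
     - series_in_deriv (\<lambda>n. v n (x, t)) (inverse (Lax u (x, t))) * inverse (Lax u (x, t)) ^ 2)"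

text \<open>The index set in \<open>Orlov\<close> changes when a time passes through 0; a fixed
  finite set is needed to differentiate along a curve.\<close>

lemma sum_times_extend:
  fixes f :: "nat \<Rightarrow> real fls"
  assumes "finite S" "\<And>n. n \<notin> S \<Longrightarrow> t n = 0" "0 \<notin> S"
  shows "(\<Sum>n | n \<ge> 1 \<and> t n \<noteq> 0. fls_const (of_nat n * t n) * f n)
    = (\<Sum>n\<in>S. fls_const (of_nat n * t n) * f n)"
  using assms by (intro sum.mono_neutral_left) (auto simp: not_le)

text \<open>The Orlov series depends on \<open>p\<close> only through the Lax series.\<close>

lemma dp_Orlov: "dp (Orlov u v q) = Orlov_deriv_Lax u v q * dp (Lax u q)"
proof -
  obtain x t where q: "q = (x, t)" by (cases q)
  let ?L = "Lax u (x, t)"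
  have "dp (\<Sum>n | n \<ge> 1 \<and> t n \<noteq> 0. fls_const (of_nat n * t n) * ?L ^ (n - 1))
     = (\<Sum>n | n \<ge> 1 \<and> t n \<noteq> 0.
          fls_const (of_nat n * t n) * (of_nat (n - 1) * ?L ^ (n - 1 - 1))) * dp ?L"
    by (simp only: dp_sum dp_const_mult dp_power sum_distrib_right mult.assoc)
  moreover have collect: "0 + B * d + c * - (w * d) = (B - c * w) * d" for B c d w :: "real fls"
    by (simp add: algebra_simps)
  ultimately show ?thesis
    by (simp only: q Orlov_def Orlov_deriv_Lax_def prod.case dp_add dp_const dp_inverse_Lax
        dp_series_in[OF vanishes_below_inverse_Lax] collect)
qed

text \<open>Stated for an arbitrary curve so that it serves both the \<open>x\<close>-derivative and
  the time derivatives. The set \<open>S\<close> contains the nonzero times at all points of the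
  curve.\<close>

lemma has_coeff_deriv_Orlov:
  fixes \<gamma> :: "real \<Rightarrow> point"
  assumes u: "\<And>n. n \<ge> 1 \<Longrightarrow> ((\<lambda>s. u n (\<gamma> s)) has_real_derivative u' n) (at s0)"
    and v: "\<And>n. n \<ge> 1 \<Longrightarrow> ((\<lambda>s. v n (\<gamma> s)) has_real_derivative v' n) (at s0)"
    and x: "((\<lambda>s. fst (\<gamma> s)) has_real_derivative x') (at s0)"
    and t: "\<And>n. ((\<lambda>s. snd (\<gamma> s) n) has_real_derivative t' n) (at s0)"
    and S: "finite S" "\<And>n s. n \<notin> S \<Longrightarrow> snd (\<gamma> s) n = 0" "0 \<notin> S"
  shows "has_coeff_deriv (\<lambda>s. Orlov u v (\<gamma> s))
    (fls_const x' + (\<Sum>n\<in>S. fls_const (of_nat n * t' n) * Lax u (\<gamma> s0) ^ (n - 1))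
      + series_in v' (inverse (Lax u (\<gamma> s0)))
      + Orlov_deriv_Lax u v (\<gamma> s0) * series_in u' fls_X) s0"
proof -
  let ?L = "\<lambda>s. Lax u (\<gamma> s)" and ?W = "\<lambda>s. inverse (Lax u (\<gamma> s))" and ?L' = "series_in u' fls_X"
  have L: "has_coeff_deriv ?L ?L' s0"
    by (rule has_coeff_deriv_Lax[OF u])
  have W: "has_coeff_deriv ?W (- (?W s0 ^ 2 * ?L')) s0"
    by (rule has_coeff_deriv_inverse[OF L vanishes_below_Lax]) (simp add: Lax_nth)
  have times: "(\<Sum>n | n \<ge> 1 \<and> snd (\<gamma> s) n \<noteq> 0. fls_const (of_nat n * snd (\<gamma> s) n) * f n)
      = (\<Sum>n\<in>S. fls_const (of_nat n * snd (\<gamma> s) n) * f n)" for s f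
    by (rule sum_times_extend[OF S(1) _ S(3)]) (rule S(2))
  have Orlov: "Orlov u v (\<gamma> s) = fls_const (fst (\<gamma> s))
      + (\<Sum>n\<in>S. fls_const (of_nat n * snd (\<gamma> s) n) * ?L s ^ (n - 1))
      + series_in (\<lambda>n. v n (\<gamma> s)) (?W s)" for s
    by (simp only: Orlov_def case_prod_unfold prod.collapse times)
  have G: "Orlov_deriv_Lax u v (\<gamma> s0)
      = (\<Sum>n\<in>S. fls_const (of_nat n * snd (\<gamma> s0) n) * (of_nat (n - 1) * ?L s0 ^ (n - 1 - 1)))
      - series_in_deriv (\<lambda>n. v n (\<gamma> s0)) (?W s0) * ?W s0 ^ 2"
    by (simp only: Orlov_deriv_Lax_def case_prod_unfold prod.collapse times)
  have "has_coeff_deriv (\<lambda>s. fls_const (fst (\<gamma> s))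
      + (\<Sum>n\<in>S. fls_const (of_nat n * snd (\<gamma> s) n) * ?L s ^ (n - 1))
      + series_in (\<lambda>n. v n (\<gamma> s)) (?W s))
      (fls_const x' + (\<Sum>n\<in>S. fls_const (of_nat n * t' n) * ?L s0 ^ (n - 1)
          + fls_const (of_nat n * snd (\<gamma> s0) n) * (of_nat (n - 1) * ?L s0 ^ (n - 1 - 1) * ?L'))
       + (series_in v' (?W s0)
          + series_in_deriv (\<lambda>n. v n (\<gamma> s0)) (?W s0) * - (?W s0 ^ 2 * ?L'))) s0"
    by (intro has_coeff_deriv_add has_coeff_deriv_sum has_coeff_deriv_mult has_coeff_deriv_power
        has_coeff_deriv_series_in has_coeff_deriv_fls_const DERIV_cmult
        S(1) L W x t v vanishes_below_inverse_Lax)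
  moreover have collect: "c + (A + B * d) + (V + e * - (w * d)) = c + A + V + (B - e * w) * d"
    for A B V c d e w :: "real fls"
    by (simp add: algebra_simps)
  ultimately show ?thesis
    unfolding Orlov G
    by (simp only: sum.distrib mult.assoc[symmetric] sum_distrib_right[symmetric] collect)
qed

subsection \<open>Partial derivatives\<close>

lemma Dx_eqI:
  assumes "has_coeff_deriv (\<lambda>s. F (s, t)) F' x"
  shows "Dx F (x, t) = F'"
proof -
  have "dx (\<lambda>q'. F q' $$ k) (x, t) = F' $$ k" for k
    using assms unfolding has_coeff_deriv_def dx_def by (auto intro: DERIV_imp_deriv)
  then show ?thesis
    by (simp add: Dx_def fls_nth_inverse)
qed

lemma Dt_eqI:
  assumes "has_coeff_deriv (\<lambda>s. F (x, t(m := s))) F' (t m)"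
  shows "Dt m F (x, t) = F'"
proof -
  have "dt m (\<lambda>q'. F q' $$ k) (x, t) = F' $$ k" for k
    using assms unfolding has_coeff_deriv_def dt_def by (auto intro: DERIV_imp_deriv)
  then show ?thesis
    by (simp add: Dt_def fls_nth_inverse)
qed

lemma smooth_onD:
  assumes "smooth_on D f"
  shows smooth_on_continuous: "continuous_on (D \<inter> slice N) f"
    and smooth_on_DERIV_x:
      "(x, t) \<in> D \<Longrightarrow> ((\<lambda>s. f (s, t)) has_real_derivative dx f (x, t)) (at x)"
    and smooth_on_DERIV_t: "m \<ge> 1 \<Longrightarrow> (x, t) \<in> D \<Longrightarrow>
      ((\<lambda>s. f (x, t(m := s))) has_real_derivative dt m f (x, t)) (at (t m))"
    and smooth_on_dx: "smooth_on D (dx f)"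
    and smooth_on_dt: "m \<ge> 1 \<Longrightarrow> smooth_on D (dt m f)"
  using assms
  by (cases rule: smooth_on.cases; simp add: dx_def dt_def DERIV_deriv_iff_real_differentiable)+

subsection \<open>Leading coefficients\<close>

text \<open>Four coefficients suffice: the equations extracted later lie at most three orders above
  the lowest one of a product.\<close>

lemma
  assumes "vanishes_below a f" "vanishes_below b g"
  shows mult_nth_0: "(f * g) $$ (a + b) = f $$ a * g $$ b"
    and mult_nth_1: "(f * g) $$ (a + b + 1) = f $$ a * g $$ (b + 1) + f $$ (a + 1) * g $$ b"
    and mult_nth_2: "(f * g) $$ (a + b + 2) =
      f $$ a * g $$ (b + 2) + f $$ (a + 1) * g $$ (b + 1) + f $$ (a + 2) * g $$ b"
    and mult_nth_3: "(f * g) $$ (a + b + 3) =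
      f $$ a * g $$ (b + 3) + f $$ (a + 1) * g $$ (b + 2) + f $$ (a + 2) * g $$ (b + 1)
        + f $$ (a + 3) * g $$ b"
  using fls_times_nth_add[OF assms, of 0] fls_times_nth_add[OF assms, of 1]
    fls_times_nth_add[OF assms, of 2] fls_times_nth_add[OF assms, of 3]
  by (simp_all add: numeral_eq_Suc algebra_simps)

lemma poly_part_nth: "poly_part F $$ k = (if k \<le> 0 then F $$ k else 0)"
proof -
  obtain N where "vanishes_below N F" using vanishes_below_ex by blast
  then show ?thesis
    unfolding poly_part_def
    by (intro nth_Abs_fls_lower_bound[of N]) (auto simp: vanishes_below_def)
qed

lemma vanishes_below_poly_part: "vanishes_below a F \<Longrightarrow> vanishes_below a (poly_part F)"
  by (simp add: vanishes_below_def poly_part_nth)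

lemma dp_nth: "dp F $$ k = - (of_int (k - 1) * F $$ (k - 1))"
  by (simp add: dp_def fls_X_power_times_conv_shift(1))

lemma inverse_nth:
  assumes "vanishes_below 0 H" "H $$ 0 = 1"
  shows "vanishes_below 0 (inverse H)" "inverse H $$ 0 = 1" "inverse H $$ 1 = - (H $$ 1)"
    "inverse H $$ 2 = (H $$ 1) ^ 2 - H $$ 2"
proof -
  show K: "vanishes_below 0 (inverse H)"
    using vanishes_below_inverse[OF assms(1)] assms(2) by simp
  have "H \<noteq> 0" using assms(2) by auto
  then have HK: "H * inverse H = 1" by simp
  show K0: "inverse H $$ 0 = 1"
    using mult_nth_0[OF assms(1) K] assms(2) by (simp add: HK)
  show K1: "inverse H $$ 1 = - (H $$ 1)"
    using mult_nth_1[OF assms(1) K] assms(2) K0 by (simp add: HK)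
  show "inverse H $$ 2 = (H $$ 1) ^ 2 - H $$ 2"
    using mult_nth_2[OF assms(1) K] assms(2) K0 K1 by (simp add: HK power2_eq_square)
qed

text \<open>Since \<open>1/L = p^(-1) - u1 p^(-3) + ...\<close>, its square has no
  \<open>p^(-3)\<close> term, and up to that order the only correction is
  \<open>- u1 a1\<close>.\<close>

lemma series_in_inverse_Lax_nth:
  fixes u q defines "W \<equiv> inverse (Lax u q)"
  shows "series_in a W $$ 1 = a 1" "series_in a W $$ 2 = a 2"
    "series_in a W $$ 3 = a 3 - u 1 q * a 1"
proof -
  have L: "vanishes_below (-1) (Lax u q)" and W: "vanishes_below 1 W"
    using vanishes_below_Lax vanishes_below_inverse_Lax by (auto simp: W_def)
  have LW: "Lax u q * W = 1" by (simp add: W_def)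
  have W1: "W $$ 1 = 1"
    using mult_nth_0[OF L W] by (simp add: LW Lax_nth)
  have W2: "W $$ 2 = 0"
    using mult_nth_1[OF L W] by (simp add: LW Lax_nth)
  have W3: "W $$ 3 = - u 1 q"
    using mult_nth_2[OF L W] W1 by (simp add: LW Lax_nth)
  have WW: "vanishes_below 2 (W ^ 2)"
    using vanishes_below_power[OF W, of 2] by simp
  have WW2: "(W ^ 2) $$ 2 = 1"
    using mult_nth_0[OF W W] W1 by (simp add: power2_eq_square)
  have WW3: "(W ^ 2) $$ 3 = 0"
    using mult_nth_1[OF W W] W1 W2 by (simp add: power2_eq_square)
  have WWW3: "(W ^ 3) $$ 3 = 1"
    using mult_nth_0[OF WW W] WW2 W1 by (simp add: power3_eq_cube power2_eq_square)
  have "series_in a W $$ int k = (\<Sum>n=1..k. a n * (W ^ n) $$ int k)" for k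
    using fls_nth_series_in_vanishes_below[OF W] by simp
  from this[of 1] this[of 2] this[of 3]
  show "series_in a W $$ 1 = a 1" "series_in a W $$ 2 = a 2"
    "series_in a W $$ 3 = a 3 - u 1 q * a 1"
    using W1 W2 W3 WW2 WW3 WWW3 by (simp_all add: numeral_eq_Suc)
qed

lemma series_in_fls_X_nth: "series_in a fls_X $$ k = (if k \<ge> 1 then a (nat k) else 0)"
  \<comment> \<open>The coefficient functions are constant, so the point is arbitrary.\<close>
  using Lax_nth[of "\<lambda>n q. a n" undefined k] by (auto simp: Lax_def fls_X_inv_nth split: if_splits)

subsection \<open>The equations on the coefficients\<close>

context
  fixes D :: "point set" and u v :: "nat \<Rightarrow> point \<Rightarrow> real"
  assumes D: "D \<subseteq> (\<Union>N. slice N)"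
    and u: "\<And>n. n \<ge> 1 \<Longrightarrow> smooth_on D (u n)" and v: "\<And>n. n \<ge> 1 \<Longrightarrow> smooth_on D (v n)"
    and LS: "Lax_Sato D (Lax u) (Orlov u v)"
begin

lemma Dx_Lax: "q \<in> D \<Longrightarrow> Dx (Lax u) q = series_in (\<lambda>n. dx (u n) q) fls_X"
  by (cases q) (simp only: Dx_eqI[OF has_coeff_deriv_Lax[OF smooth_on_DERIV_x[OF u]]])

lemma Dt_Lax: "m \<ge> 1 \<Longrightarrow> q \<in> D \<Longrightarrow> Dt m (Lax u) q = series_in (\<lambda>n. dt m (u n) q) fls_X"
  by (cases q) (simp only: Dt_eqI[OF has_coeff_deriv_Lax[OF smooth_on_DERIV_t[OF u]]])

lemma Dx_Orlov:
  assumes "q \<in> D"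
  shows "Dx (Orlov u v) q = 1 + series_in (\<lambda>n. dx (v n) q) (inverse (Lax u q))
    + Orlov_deriv_Lax u v q * Dx (Lax u) q"
proof -
  obtain x t where q: "q = (x, t)" by (cases q)
  obtain N where N: "t 0 = 0" "\<And>n. n > N \<Longrightarrow> t n = 0"
    using D assms by (auto simp: q slice_def)
  \<comment> \<open>The times are constant along the \<open>x\<close>-line, hence the factors 0; the
    summand 1 comes from the explicit \<open>x\<close>.\<close>
  have "Dx (Orlov u v) (x, t) = fls_const 1 + (\<Sum>n\<in>{1..N}. fls_const (of_nat n * 0) * Lax u (x, t) ^ (n - 1))
      + series_in (\<lambda>n. dx (v n) q) (inverse (Lax u (x, t)))
      + Orlov_deriv_Lax u v (x, t) * series_in (\<lambda>n. dx (u n) q) fls_X"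
    using assms N unfolding q
    by (intro Dx_eqI has_coeff_deriv_Orlov smooth_on_DERIV_x[OF u] smooth_on_DERIV_x[OF v])
       (auto simp: not_le)
  then show ?thesis
    by (simp add: Dx_Lax[OF assms]) (simp add: q)
qed

lemma Dt_Orlov:
  assumes "q \<in> D" "m \<ge> 1"
  shows "Dt m (Orlov u v) q = of_nat m * Lax u q ^ (m - 1)
    + series_in (\<lambda>n. dt m (v n) q) (inverse (Lax u q)) + Orlov_deriv_Lax u v q * Dt m (Lax u) q"
proof -
  obtain x t where q: "q = (x, t)" by (cases q)
  obtain N where N: "t 0 = 0" "\<And>n. n > N \<Longrightarrow> t n = 0"
    using D assms by (auto simp: q slice_def)
  \<comment> \<open>The index \<open>m\<close> must be included even if \<open>t m = 0\<close>,
    since this time varies along the curve.\<close>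
  let ?S = "{1..max N m}" and ?t' = "\<lambda>n. if n = m then 1 else 0"
  have "Dt m (Orlov u v) (x, t) = fls_const 0
      + (\<Sum>n\<in>?S. fls_const (of_nat n * ?t' n) * Lax u (x, t(m := t m)) ^ (n - 1))
      + series_in (\<lambda>n. dt m (v n) q) (inverse (Lax u (x, t(m := t m))))
      + Orlov_deriv_Lax u v (x, t(m := t m)) * series_in (\<lambda>n. dt m (u n) q) fls_X"
    using assms N unfolding q
    by (intro Dt_eqI has_coeff_deriv_Orlov smooth_on_DERIV_t[OF u] smooth_on_DERIV_t[OF v])
       (auto simp: not_le)
  moreover have "(\<Sum>n\<in>?S. fls_const (of_nat n * ?t' n) * Lax u (x, t(m := t m)) ^ (n - 1))
      = (\<Sum>n\<in>?S. if n = m then of_nat m * Lax u q ^ (m - 1) else 0)"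
    by (intro sum.cong refl) (simp add: q fls_of_nat)
  moreover have "\<dots> = of_nat m * Lax u q ^ (m - 1)"
    using assms(2) by simp
  ultimately show ?thesis
    unfolding Dt_Lax[OF assms(2,1)] by (simp only: q fun_upd_triv fls_const_0 add_0_left)
qed

lemma Dx_Lax_power:
  assumes "q \<in> D"
  shows "Dx (\<lambda>q'. Lax u q' ^ n) q = of_nat n * Lax u q ^ (n - 1) * Dx (Lax u) q"
proof -
  obtain x t where q: "q = (x, t)" by (cases q)
  have "has_coeff_deriv (\<lambda>s. Lax u (s, t)) (series_in (\<lambda>n. dx (u n) q) fls_X) x"
    unfolding q by (rule has_coeff_deriv_Lax, rule smooth_on_DERIV_x[OF u]) (use assms q in auto)
  from Dx_eqI[OF has_coeff_deriv_power[OF this]] show ?thesis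
    unfolding Dx_Lax[OF assms] by (simp only: q)
qed

text \<open>\<open>\<partial>\<M>/\<partial>x\<close> with \<open>\<L>\<close> held fixed.\<close>

definition Orlov_x :: "point \<Rightarrow> real fls" where
  "Orlov_x q = 1 + series_in (\<lambda>n. dx (v n) q) (inverse (Lax u q))"

lemma Orlov_x_nth:
  "vanishes_below 0 (Orlov_x q)" "Orlov_x q $$ 0 = 1" "Orlov_x q $$ 1 = dx (v 1) q"
  "Orlov_x q $$ 2 = dx (v 2) q" "Orlov_x q $$ 3 = dx (v 3) q - u 1 q * dx (v 1) q"
proof -
  have S: "vanishes_below 1 (series_in (\<lambda>n. dx (v n) q) (inverse (Lax u q)))"
    by (intro vanishes_below_series_in vanishes_below_inverse_Lax)
  show "vanishes_below 0 (Orlov_x q)"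
    unfolding Orlov_x_def by (intro vanishes_below_add vanishes_below_1 vanishes_below_mono[OF S]) simp
  show "Orlov_x q $$ 0 = 1"
    using vanishes_below_nth[OF S, of 0] by (simp add: Orlov_x_def)
  show "Orlov_x q $$ 1 = dx (v 1) q" "Orlov_x q $$ 2 = dx (v 2) q"
    "Orlov_x q $$ 3 = dx (v 3) q - u 1 q * dx (v 1) q"
    unfolding Orlov_x_def by (simp_all only: fls_plus_nth series_in_inverse_Lax_nth) simp_all
qed

lemma dp_Lax_nth:
  "vanishes_below 0 (dp (Lax u q))" "dp (Lax u q) $$ 0 = 1" "dp (Lax u q) $$ 1 = 0"
  "dp (Lax u q) $$ 2 = - u 1 q"
  by (simp_all add: vanishes_below_def dp_nth Lax_nth)

text \<open>The terms with \<open>Orlov_deriv_Lax\<close> form a multiple of the Lax row of the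
  determinant and cancel.\<close>

lemma J0_eq:
  assumes "q \<in> D"
  shows "J0 (Lax u) (Orlov u v) q = dp (Lax u q) * Orlov_x q"
  unfolding J0_def Dx_Orlov[OF assms] dp_Orlov Orlov_x_def
  by (simp add: algebra_simps)

text \<open>The factor \<open>L_p\<close> of \<open>J0\<close> cancels against the one from
  \<open>dp (L ^ n)\<close>.\<close>

lemma A_coeff_eq:
  assumes "q \<in> D"
  shows "A_coeff (Lax u) (Orlov u v) n q
    = poly_part (of_nat n * (Lax u q ^ (n - 1) * inverse (Orlov_x q)))"
proof -
  have "dp (Lax u q) \<noteq> 0" "Orlov_x q \<noteq> 0"
    using dp_Lax_nth(2)[of q] Orlov_x_nth(2)[of q] by auto
  then show ?thesis
    by (simp add: A_coeff_def J0_eq[OF assms] dp_power field_simps)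
qed

lemma B_coeff_eq:
  assumes "q \<in> D"
  shows "B_coeff (Lax u) (Orlov u v) n q
    = poly_part (of_nat n * (Lax u q ^ (n - 1)
        * (inverse (Orlov_x q) * inverse (dp (Lax u q)) * Dx (Lax u) q)))"
proof -
  have "dp (Lax u q) \<noteq> 0" "Orlov_x q \<noteq> 0"
    using dp_Lax_nth(2)[of q] Orlov_x_nth(2)[of q] by auto
  then show ?thesis
    by (simp add: B_coeff_def J0_eq[OF assms] Dx_Lax_power[OF assms] field_simps)
qed

lemma Lax_equation:
  assumes "q \<in> D" "m \<ge> 1"
  shows "Dt m (Lax u) q = A_coeff (Lax u) (Orlov u v) m q * Dx (Lax u) q
    - B_coeff (Lax u) (Orlov u v) m q * dp (Lax u q)"
  using LS assms by (auto simp: Lax_Sato_def)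

text \<open>The multiple of the Lax equation by \<open>\<partial>\<M>/\<partial>\<L>\<close> cancels from the Orlov equation.\<close>

lemma Orlov_equation:
  assumes "q \<in> D" "m \<ge> 1"
  shows "of_nat m * Lax u q ^ (m - 1) + series_in (\<lambda>n. dt m (v n) q) (inverse (Lax u q))
    = A_coeff (Lax u) (Orlov u v) m q * Orlov_x q"
proof -
  let ?A = "A_coeff (Lax u) (Orlov u v) m q" and ?B = "B_coeff (Lax u) (Orlov u v) m q"
  have "Dt m (Orlov u v) q = ?A * Dx (Orlov u v) q - ?B * dp (Orlov u v q)"
    using LS assms by (auto simp: Lax_Sato_def)
  then show ?thesis
    unfolding Dx_Orlov[OF assms(1)] Dt_Orlov[OF assms] dp_Orlov Orlov_x_def
      Lax_equation[OF assms]
    by (simp only: algebra_simps) (simp add: algebra_simps)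
qed

section \<open>Low-order coefficients and the resulting first-order equations\<close>

lemma Dx_Lax_nth:
  assumes "q \<in> D"
  shows "vanishes_below 1 (Dx (Lax u) q)" "Dx (Lax u) q $$ 1 = dx (u 1) q"
    "Dx (Lax u) q $$ 2 = dx (u 2) q" "Dx (Lax u) q $$ 3 = dx (u 3) q"
  unfolding Dx_Lax[OF assms] by (simp_all add: vanishes_below_def series_in_fls_X_nth)

lemma Lax_power2_nth:
  "vanishes_below (-2) (Lax u q ^ 2)" "Lax u q ^ 2 $$ -2 = 1" "Lax u q ^ 2 $$ -1 = 0"
  "Lax u q ^ 2 $$ 0 = 2 * u 1 q" "Lax u q ^ 2 $$ 1 = 2 * u 2 q"
proof -
  note L = vanishes_below_Lax[of u q]
  show "vanishes_below (-2) (Lax u q ^ 2)"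
    using vanishes_below_power[OF L, of 2] by simp
  show "Lax u q ^ 2 $$ -2 = 1" "Lax u q ^ 2 $$ -1 = 0"
    "Lax u q ^ 2 $$ 0 = 2 * u 1 q" "Lax u q ^ 2 $$ 1 = 2 * u 2 q"
    using mult_nth_0[OF L L] mult_nth_1[OF L L] mult_nth_2[OF L L] mult_nth_3[OF L L]
    by (simp_all add: power2_eq_square Lax_nth)
qed

text \<open>Multiply \<open>1/H = 1 - v1_x p^(-1) + (v1_x^2 - v2_x) p^(-2) + ...\<close>, where
  \<open>H\<close> is \<open>Orlov_x\<close>, by \<open>2 L\<close> and by
  \<open>3 L^2 = 3 p^2 + 6 u1 + ...\<close>.\<close>

lemma A_coeff_nth:
  assumes "q \<in> D"
  defines "A \<equiv> \<lambda>n. A_coeff (Lax u) (Orlov u v) n q"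
  shows "vanishes_below (-1) (A 2)" "A 2 $$ -1 = 2" "A 2 $$ 0 = - 2 * dx (v 1) q"
    "\<And>n k. k > 0 \<Longrightarrow> A n $$ k = 0"
    "vanishes_below (-2) (A 3)" "A 3 $$ -2 = 3" "A 3 $$ -1 = - 3 * dx (v 1) q"
    "A 3 $$ 0 = 3 * ((dx (v 1) q) ^ 2 - dx (v 2) q) + 6 * u 1 q"
proof -
  define K where "K = inverse (Orlov_x q)"
  note K = inverse_nth[OF Orlov_x_nth(1,2)[of q], unfolded Orlov_x_nth, folded K_def]
  note L = vanishes_below_Lax[of u q] and LL = Lax_power2_nth[of q]
  have A2: "A 2 = poly_part (of_nat 2 * (Lax u q * K))"
    and A3: "A 3 = poly_part (of_nat 3 * (Lax u q ^ 2 * K))"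
    by (simp_all only: A_def A_coeff_eq[OF assms(1)] K_def) simp_all
  show "\<And>n k. k > 0 \<Longrightarrow> A n $$ k = 0"
    by (simp add: A_def A_coeff_eq[OF assms(1)] poly_part_nth)
  show "vanishes_below (-1) (A 2)"
    using vanishes_below_mult[OF L K(1)] unfolding A2
    by (intro vanishes_below_poly_part) (simp add: vanishes_below_def)
  show "vanishes_below (-2) (A 3)"
    using vanishes_below_mult[OF LL(1) K(1)] unfolding A3
    by (intro vanishes_below_poly_part) (simp add: vanishes_below_def)
  show "A 2 $$ -1 = 2" "A 2 $$ 0 = - 2 * dx (v 1) q"
    using mult_nth_0[OF L K(1)] mult_nth_1[OF L K(1)] K
    unfolding A2 poly_part_nth fls_mult_of_nat_nth by (simp_all add: Lax_nth)
  show "A 3 $$ -2 = 3" "A 3 $$ -1 = - 3 * dx (v 1) q"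
    "A 3 $$ 0 = 3 * ((dx (v 1) q) ^ 2 - dx (v 2) q) + 6 * u 1 q"
    using mult_nth_0[OF LL(1) K(1)] mult_nth_1[OF LL(1) K(1)] mult_nth_2[OF LL(1) K(1)] K LL
    unfolding A3 poly_part_nth fls_mult_of_nat_nth by (simp_all add: algebra_simps)
qed

lemma B_coeff_nth:
  assumes "q \<in> D"
  defines "B \<equiv> \<lambda>n. B_coeff (Lax u) (Orlov u v) n q"
  shows "vanishes_below 0 (B 2)" "B 2 $$ 0 = 2 * dx (u 1) q"
    "\<And>n k. k > 0 \<Longrightarrow> B n $$ k = 0"
    "vanishes_below (-1) (B 3)" "B 3 $$ -1 = 3 * dx (u 1) q"
    "B 3 $$ 0 = 3 * (dx (u 2) q - dx (v 1) q * dx (u 1) q)"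
proof -
  define K where "K = inverse (Orlov_x q)"
  define N where "N = inverse (dp (Lax u q))"
  define R where "R = K * N * Dx (Lax u) q"
  note K = inverse_nth[OF Orlov_x_nth(1,2)[of q], unfolded Orlov_x_nth, folded K_def]
  note N = inverse_nth[OF dp_Lax_nth(1,2)[of q], unfolded dp_Lax_nth, folded N_def]
  note L = vanishes_below_Lax[of u q] and LL = Lax_power2_nth[of q] and Lx = Dx_Lax_nth[OF assms(1)]
  \<comment> \<open>\<open>L_p\<close> has no \<open>p^(-1)\<close> term, so to this order the
    product agrees with \<open>K\<close>.\<close>
  have KN: "vanishes_below 0 (K * N)" "(K * N) $$ 0 = 1" "(K * N) $$ 1 = - dx (v 1) q"
    using vanishes_below_mult[OF K(1) N(1)] mult_nth_0[OF K(1) N(1)] mult_nth_1[OF K(1) N(1)] K N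
    by simp_all
  have R: "vanishes_below 1 R" "R $$ 1 = dx (u 1) q" "R $$ 2 = dx (u 2) q - dx (v 1) q * dx (u 1) q"
    using vanishes_below_mult[OF KN(1) Lx(1)] mult_nth_0[OF KN(1) Lx(1)] mult_nth_1[OF KN(1) Lx(1)]
      KN Lx by (simp_all add: R_def)
  have B2: "B 2 = poly_part (of_nat 2 * (Lax u q * R))"
    and B3: "B 3 = poly_part (of_nat 3 * (Lax u q ^ 2 * R))"
    by (simp_all only: B_def B_coeff_eq[OF assms(1)] R_def K_def N_def) simp_all
  show "\<And>n k. k > 0 \<Longrightarrow> B n $$ k = 0"
    by (simp add: B_def B_coeff_eq[OF assms(1)] poly_part_nth)
  show "vanishes_below 0 (B 2)"
    using vanishes_below_mult[OF L R(1)] unfolding B2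
    by (intro vanishes_below_poly_part) (simp add: vanishes_below_def)
  show "vanishes_below (-1) (B 3)"
    using vanishes_below_mult[OF LL(1) R(1)] unfolding B3
    by (intro vanishes_below_poly_part) (simp add: vanishes_below_def)
  show "B 2 $$ 0 = 2 * dx (u 1) q"
    using mult_nth_0[OF L R(1)] R
    unfolding B2 poly_part_nth fls_mult_of_nat_nth by (simp add: Lax_nth)
  show "B 3 $$ -1 = 3 * dx (u 1) q" "B 3 $$ 0 = 3 * (dx (u 2) q - dx (v 1) q * dx (u 1) q)"
    using mult_nth_0[OF LL(1) R(1)] mult_nth_1[OF LL(1) R(1)] R LL
    unfolding B3 poly_part_nth fls_mult_of_nat_nth by simp_all
qed

text \<open>Coefficients of \<open>p^(-1)\<close> and \<open>p^(-2)\<close> for \<open>t_2\<close>,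
  and of \<open>p^(-1)\<close> for \<open>t_3\<close>, in \<open>Orlov_equation\<close>;
  \<open>A\<close> has no negative powers of \<open>p\<close>, so the products are short.\<close>

lemma v_equations:
  assumes "q \<in> D"
  shows "2 * u 1 q + dt 2 (v 1) q = 2 * dx (v 2) q - 2 * (dx (v 1) q) ^ 2"
    "2 * u 2 q + dt 2 (v 2) q
      = 2 * (dx (v 3) q - u 1 q * dx (v 1) q) - 2 * dx (v 1) q * dx (v 2) q"
    "6 * u 2 q + dt 3 (v 1) q
      = 3 * (dx (v 3) q - u 1 q * dx (v 1) q) - 3 * dx (v 1) q * dx (v 2) q
        + (3 * ((dx (v 1) q) ^ 2 - dx (v 2) q) + 6 * u 1 q) * dx (v 1) q"
proof -
  note A = A_coeff_nth[OF assms] and H = Orlov_x_nth[of q]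
  have eq: "(of_nat m * Lax u q ^ (m - 1)) $$ k
      + series_in (\<lambda>n. dt m (v n) q) (inverse (Lax u q)) $$ k
    = (A_coeff (Lax u) (Orlov u v) m q * Orlov_x q) $$ k" if "m \<ge> 1" for m k
    unfolding Orlov_equation[OF assms that, symmetric] by simp
  show "2 * u 1 q + dt 2 (v 1) q = 2 * dx (v 2) q - 2 * (dx (v 1) q) ^ 2"
    using eq[of 2 1, unfolded series_in_inverse_Lax_nth fls_mult_of_nat_nth]
      mult_nth_2[OF A(1) H(1)] A H
    by (simp add: Lax_nth power2_eq_square)
  show "2 * u 2 q + dt 2 (v 2) q
      = 2 * (dx (v 3) q - u 1 q * dx (v 1) q) - 2 * dx (v 1) q * dx (v 2) q"
    using eq[of 2 2, unfolded series_in_inverse_Lax_nth fls_mult_of_nat_nth]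
      mult_nth_3[OF A(1) H(1)] A H
    by (simp add: Lax_nth)
  show "6 * u 2 q + dt 3 (v 1) q
      = 3 * (dx (v 3) q - u 1 q * dx (v 1) q) - 3 * dx (v 1) q * dx (v 2) q
        + (3 * ((dx (v 1) q) ^ 2 - dx (v 2) q) + 6 * u 1 q) * dx (v 1) q"
    using eq[of 3 1, unfolded series_in_inverse_Lax_nth fls_mult_of_nat_nth]
      mult_nth_3[OF A(5) H(1)] A H Lax_power2_nth[of q]
    by simp
qed

text \<open>The same three coefficients, taken in \<open>Lax_equation\<close>.\<close>

lemma u_equations:
  assumes "q \<in> D"
  shows "dt 2 (u 1) q = 2 * dx (u 2) q - 2 * dx (v 1) q * dx (u 1) q"
    "dt 2 (u 2) q
      = 2 * dx (u 3) q - 2 * dx (v 1) q * dx (u 2) q + 2 * u 1 q * dx (u 1) q"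
    "dt 3 (u 1) q
      = 3 * dx (u 3) q - 3 * dx (v 1) q * dx (u 2) q
        + (3 * ((dx (v 1) q) ^ 2 - dx (v 2) q) + 6 * u 1 q) * dx (u 1) q
        + 3 * u 1 q * dx (u 1) q"
proof -
  note A = A_coeff_nth[OF assms] and B = B_coeff_nth[OF assms]
    and Lx = Dx_Lax_nth[OF assms] and Lp = dp_Lax_nth[of q]
  have eq: "(if k \<ge> 1 then dt m (u (nat k)) q else 0)
      = (A_coeff (Lax u) (Orlov u v) m q * Dx (Lax u) q) $$ k
        - (B_coeff (Lax u) (Orlov u v) m q * dp (Lax u q)) $$ k" if "m \<ge> 1" for m k
    using Lax_equation[OF assms that] unfolding Dt_Lax[OF that assms]
    by (metis series_in_fls_X_nth fls_minus_nth)
  show "dt 2 (u 1) q = 2 * dx (u 2) q - 2 * dx (v 1) q * dx (u 1) q"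
    using eq[of 2 1] mult_nth_1[OF A(1) Lx(1)] mult_nth_1[OF B(1) Lp(1)] A B Lx Lp
    by simp
  show "dt 2 (u 2) q
      = 2 * dx (u 3) q - 2 * dx (v 1) q * dx (u 2) q + 2 * u 1 q * dx (u 1) q"
    using eq[of 2 2] mult_nth_2[OF A(1) Lx(1)] mult_nth_2[OF B(1) Lp(1)] A B Lx Lp
    by simp
  show "dt 3 (u 1) q
      = 3 * dx (u 3) q - 3 * dx (v 1) q * dx (u 2) q
        + (3 * ((dx (v 1) q) ^ 2 - dx (v 2) q) + 6 * u 1 q) * dx (u 1) q
        + 3 * u 1 q * dx (u 1) q"
    using eq[of 3 1] mult_nth_2[OF A(5) Lx(1)] mult_nth_2[OF B(4) Lp(1)] A B Lx Lp
    by simp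
qed

section \<open>Elimination of \<open>u 3\<close> and \<open>v 3\<close>\<close>

lemma v2_x: "q \<in> D \<Longrightarrow> dx (v 2) q = u 1 q + dt 2 (v 1) q / 2 + (dx (v 1) q) ^ 2"
  using v_equations(1)[of q] by (simp add: field_simps)

text \<open>Subtracting 3/2 times the \<open>t_2\<close>-equation of \<open>u 2\<close> removes
  \<open>dx (u 3)\<close> and \<open>dx (u 2)\<close>; \<open>v2_x\<close> removes
  \<open>dx (v 2)\<close>.\<close>

lemma u_flow_3:
  assumes "q \<in> D"
  shows "dt 3 (u 1) q = 3/2 * dt 2 (u 2) q + 3 * (u 1 q * dx (u 1) q)
      - 3/2 * (dt 2 (v 1) q * dx (u 1) q)"
  using u_equations(2,3)[OF assms] unfolding v2_x[OF assms] by algebra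

lemma v_flow_3:
  assumes "q \<in> D"
  shows "dt 3 (v 1) q = 3/2 * dt 2 (v 2) q + 3 * (u 1 q * dx (v 1) q)
      - 3/2 * (dx (v 1) q * dt 2 (v 1) q) - 3 * u 2 q"
  using v_equations(2,3)[OF assms] unfolding v2_x[OF assms] by algebra

lemma u_flow_2:
  assumes "q \<in> D"
  shows "dt 2 (u 1) q = 2 * dx (u 2) q - 2 * (dx (v 1) q * dx (u 1) q)"
  using u_equations(1)[OF assms] by simp

text \<open>The square is written as a product so that the product rule applies directly when this
  is differentiated again.\<close>

lemma v_flow_2:
  assumes "q \<in> D"
  shows "dt 2 (v 1) q = 2 * dx (v 2) q - 2 * (dx (v 1) q * dx (v 1) q) - 2 * u 1 q"
  using v_equations(1)[OF assms] by (simp add: power2_eq_square)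

end

subsection \<open>Symmetry of the mixed partial derivatives\<close>

text \<open>The double difference of \<open>f\<close> over a small square is, by the mean value
  theorem in either order, \<open>h^2\<close> times a value of \<open>fxy\<close> and
  \<open>h^2\<close> times a value of \<open>fyx\<close>. Continuity keeps these values apart if
  they differ at the corner.\<close>

lemma mixed_partials_eq:
  fixes f :: "real \<Rightarrow> real \<Rightarrow> real"
  assumes U: "open U" "(a, b) \<in> U"
    and fx: "\<And>s r. (s, r) \<in> U \<Longrightarrow> ((\<lambda>s. f s r) has_real_derivative fx s r) (at s)"
    and fy: "\<And>s r. (s, r) \<in> U \<Longrightarrow> ((\<lambda>r. f s r) has_real_derivative fy s r) (at r)"
    and fxy: "\<And>s r. (s, r) \<in> U \<Longrightarrow> ((\<lambda>r. fx s r) has_real_derivative fxy s r) (at r)"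
    and fyx: "\<And>s r. (s, r) \<in> U \<Longrightarrow> ((\<lambda>s. fy s r) has_real_derivative fyx s r) (at s)"
    and cont: "continuous_on U (\<lambda>p. fxy (fst p) (snd p))" "continuous_on U (\<lambda>p. fyx (fst p) (snd p))"
  shows "fxy a b = fyx a b"
proof (rule ccontr)
  assume neq: "fxy a b \<noteq> fyx a b"
  define e where "e = \<bar>fxy a b - fyx a b\<bar> / 2"
  have e: "e > 0" using neq by (simp add: e_def)
  have near: "\<forall>\<^sub>F p in at (a, b). p \<in> U \<and> dist (g p) (g (a, b)) < e"
    if "continuous_on U g" for g :: "real \<times> real \<Rightarrow> real"
  proof -
    have "(g \<longlongrightarrow> g (a, b)) (at (a, b))"
      using that U by (metis continuous_on_eq_continuous_at isCont_def)
    from tendstoD[OF this e] show ?thesis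
      using U eventually_at_topological by (force elim: eventually_elim2)
  qed
  from near[OF cont(1)] near[OF cont(2)]
  have "\<forall>\<^sub>F p in at (a, b). p \<in> U \<and> dist (fxy (fst p) (snd p)) (fxy a b) < e
      \<and> dist (fyx (fst p) (snd p)) (fyx a b) < e"
    by eventually_elim auto
  then obtain d where d: "d > 0" and close: "\<And>p. p \<noteq> (a, b) \<Longrightarrow> dist p (a, b) < d \<Longrightarrow>
      p \<in> U \<and> dist (fxy (fst p) (snd p)) (fxy a b) < e \<and> dist (fyx (fst p) (snd p)) (fyx a b) < e"
    unfolding eventually_at by auto
  \<comment> \<open>Points of the square are then within \<open>2 * h < d\<close> of the
    corner.\<close>
  define h where "h = d / 3"
  have h: "h > 0" using d by (simp add: h_def)
  have box: "(s, r) \<in> U" "dist (fxy s r) (fxy a b) < e" "dist (fyx s r) (fyx a b) < e"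
    if "a \<le> s" "s \<le> a + h" "b \<le> r" "r \<le> b + h" for s r
  proof -
    have "dist (s, r) (a, b) \<le> \<bar>s - a\<bar> + \<bar>r - b\<bar>"
      using sqrt_sum_squares_le_sum_abs[of "s - a" "r - b"] by (simp add: dist_Pair_Pair dist_real_def)
    also have "\<dots> < d" using that d by (simp add: h_def)
    finally show "(s, r) \<in> U" "dist (fxy s r) (fxy a b) < e" "dist (fyx s r) (fyx a b) < e"
      using close[of "(s, r)"] U(2) e by (cases "(s, r) = (a, b)"; auto)+
  qed
  let ?\<Delta> = "f (a + h) (b + h) - f (a + h) b - (f a (b + h) - f a b)"
  have "\<exists>s>a. s < a + h \<and> ?\<Delta> = (a + h - a) * (fx s (b + h) - fx s b)"
    by (rule MVT2[of a "a + h" "\<lambda>s. f s (b + h) - f s b"])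
       (use h in \<open>auto intro!: DERIV_diff fx box\<close>)
  then obtain s where s: "a < s" "s < a + h" "?\<Delta> = h * (fx s (b + h) - fx s b)"
    by auto
  have "\<exists>r>b. r < b + h \<and> fx s (b + h) - fx s b = (b + h - b) * fxy s r"
    by (rule MVT2) (use h s in \<open>auto intro!: fxy box\<close>)
  then obtain r where r: "b < r" "r < b + h" "fx s (b + h) - fx s b = h * fxy s r"
    by auto
  have "\<exists>r>b. r < b + h \<and> f (a + h) (b + h) - f a (b + h) - (f (a + h) b - f a b)
      = (b + h - b) * (fy (a + h) r - fy a r)"
    by (rule MVT2[of b "b + h" "\<lambda>r. f (a + h) r - f a r"])
       (use h in \<open>auto intro!: DERIV_diff fy box\<close>)
  then obtain r' where r': "b < r'" "r' < b + h" "?\<Delta> = h * (fy (a + h) r' - fy a r')"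
    by auto
  have "\<exists>s>a. s < a + h \<and> fy (a + h) r' - fy a r' = (a + h - a) * fyx s r'"
    by (rule MVT2) (use h r' in \<open>auto intro!: fyx box\<close>)
  then obtain s' where s': "a < s'" "s' < a + h" "fy (a + h) r' - fy a r' = h * fyx s' r'"
    by auto
  have "fxy s r = fyx s' r'"
    using s(3) r(3) r'(3) s'(3) h by simp
  then show False
    using box(2)[of s r] box(3)[of s' r'] s r s' r' unfolding e_def dist_real_def by argo
qed


lemma continuous_on_plane: "continuous_on S (\<lambda>p. (fst p, t(m := snd p)) :: point)"
proof -
  have "continuous_on S (\<lambda>p. if n = m then snd p else t n)" for n :: nat
    by (cases "n = m") (auto intro: continuous_intros)
  then show ?thesis
    by (intro continuous_on_Pair continuous_on_fst continuous_on_id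
        continuous_on_coordinatewise_then_product) (simp_all add: fun_upd_def)
qed

text \<open>\<open>D\<close> is open only relative to slices, but varying \<open>x\<close> and
  \<open>t m\<close> alone stays within the slice of index \<open>max N m\<close>.\<close>

lemma open_plane_section:
  assumes D: "is_domain D" and xt: "(x, t) \<in> D" and m: "m \<ge> 1"
  shows "open {p. (fst p, t(m := snd p)) \<in> D}"
    and "\<exists>N. \<forall>p. (fst p, t(m := snd p)) \<in> slice N"
proof -
  have "(x, t) \<in> (\<Union>N. slice N)"
    using D xt unfolding is_domain_def by blast
  then obtain N where "t 0 = 0" "\<And>n. n > N \<Longrightarrow> t n = 0"
    by (auto simp: slice_def)
  then have slice: "(s, t(m := r)) \<in> slice (max N m)" for s r
    using m by (auto simp: slice_def)
  then show "\<exists>N. \<forall>p. (fst p, t(m := snd p)) \<in> slice N"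
    by auto
  have "openin (top_of_set (slice (max N m))) (D \<inter> slice (max N m))"
    using D unfolding is_domain_def by blast
  then obtain U where U: "open U" "D \<inter> slice (max N m) = slice (max N m) \<inter> U"
    by (auto simp: openin_open)
  have "{p. (fst p, t(m := snd p)) \<in> D} = (\<lambda>p. (fst p, t(m := snd p))) -` U"
    using U(2) slice by fastforce
  then show "open {p. (fst p, t(m := snd p)) \<in> D}"
    using open_vimage[OF U(1) continuous_on_plane] by simp
qed

text \<open>Restricting to the plane of \<open>x\<close> and \<open>t m\<close> reduces this to
  \<open>mixed_partials_eq\<close> on an open subset of the plane.\<close>

lemma dx_dt_commute:
  assumes D: "is_domain D" and f: "smooth_on D f" and q: "q \<in> D" and m: "m \<ge> 1"
  shows "dx (dt m f) q = dt m (dx f) q"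
proof -
  obtain x t where xt: "q = (x, t)" by (cases q)
  let ?\<phi> = "\<lambda>p. (fst p, t(m := snd p)) :: point"
  define U where "U = {p. ?\<phi> p \<in> D}"
  have U: "open U" "(x, t m) \<in> U"
    using open_plane_section(1)[OF D q[unfolded xt] m] q by (auto simp: U_def xt)
  obtain N where N: "?\<phi> p \<in> slice N" for p
    using open_plane_section(2)[OF D q[unfolded xt] m] by blast
  have cont: "continuous_on U (\<lambda>p. g (?\<phi> p))" if "smooth_on D g" for g
    using N by (intro continuous_on_compose2[OF smooth_on_continuous[OF that, of N]]
        continuous_on_subset[OF continuous_on_plane]) (auto simp: U_def)
  have t: "((\<lambda>r. g (s, t(m := r))) has_real_derivative dt m g (s, t(m := r))) (at r)"
    if "smooth_on D g" "(s, r) \<in> U" for g s r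
    using smooth_on_DERIV_t[OF that(1) m, of s "t(m := r)"] that(2) by (simp add: U_def)
  have x: "((\<lambda>s. g (s, t(m := r))) has_real_derivative dx g (s, t(m := r))) (at s)"
    if "smooth_on D g" "(s, r) \<in> U" for g s r
    using smooth_on_DERIV_x[OF that(1)] that(2) by (simp add: U_def)
  have "dt m (dx f) (x, t(m := t m)) = dx (dt m f) (x, t(m := t m))"
    by (rule mixed_partials_eq[OF U, of "\<lambda>s r. f (s, t(m := r))"
          "\<lambda>s r. dx f (s, t(m := r))" "\<lambda>s r. dt m f (s, t(m := r))"])
       (intro x t cont smooth_on_dx smooth_on_dt f m | assumption)+
  then show ?thesis
    by (simp add: xt)
qed

section \<open>Differentiation of identities valid on the domain\<close>

lemma dx_eqI:
  assumes D: "is_domain D" "(x, t) \<in> D" and eq: "\<And>q. q \<in> D \<Longrightarrow> f q = g q"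
    and g: "((\<lambda>s. g (s, t)) has_real_derivative d) (at x)"
  shows "dx f (x, t) = d"
proof -
  \<comment> \<open>The \<open>x\<close>-line is cut out of the plane of \<open>x\<close> and
    \<open>t 1\<close> by keeping \<open>t 1\<close> fixed.\<close>
  let ?S = "(\<lambda>s. (s, t 1)) -` {p. (fst p, t(1 := snd p)) \<in> D}"
  have S: "open ?S"
    by (intro open_vimage open_plane_section(1)[OF D]) (auto intro!: continuous_intros)
  have "((\<lambda>s. f (s, t)) has_real_derivative d) (at x)"
    by (rule has_field_derivative_transform_within_open[OF g S]) (use D(2) in \<open>auto simp: eq\<close>)
  then show ?thesis
    by (simp add: dx_def DERIV_imp_deriv)
qed

lemma dt_eqI:
  assumes D: "is_domain D" "(x, t) \<in> D" and m: "m \<ge> 1" and eq: "\<And>q. q \<in> D \<Longrightarrow> f q = g q"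
    and g: "((\<lambda>s. g (x, t(m := s))) has_real_derivative d) (at (t m))"
  shows "dt m f (x, t) = d"
proof -
  let ?S = "(\<lambda>s. (x, s)) -` {p. (fst p, t(m := snd p)) \<in> D}"
  have S: "open ?S"
    by (intro open_vimage open_plane_section(1)[OF D m]) (auto intro!: continuous_intros)
  have "((\<lambda>s. f (x, t(m := s))) has_real_derivative d) (at (t m))"
    by (rule has_field_derivative_transform_within_open[OF g S]) (use D(2) in \<open>auto simp: eq\<close>)
  then show ?thesis
    by (simp add: dt_def DERIV_imp_deriv)
qed

section \<open>Elimination of \<open>u 2\<close> and \<open>v 2\<close>\<close>

theorem mainTheorem1:
  fixes D :: "point set" and u v :: "nat \<Rightarrow> point \<Rightarrow> real"
  assumes "is_domain D"
    and "\<And>n. n \<ge> 1 \<Longrightarrow> smooth_on D (u n)" "\<And>n. n \<ge> 1 \<Longrightarrow> smooth_on D (v n)"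
    and "\<And>n. n \<ge> 1 \<Longrightarrow> via_t1_plus_x D (u n)" "\<And>n. n \<ge> 1 \<Longrightarrow> via_t1_plus_x D (v n)"
    and "Lax_Sato D (Lax u) (Orlov u v)"
  shows "\<forall>q\<in>D.
      1/3 * dt 3 (dx (u 1)) q =
        1/4 * dt 2 (dt 2 (u 1)) q + dx (\<lambda>r. u 1 r * dx (u 1) r) q
        + 1/2 * dx (v 1) q * dt 2 (dx (u 1)) q - 1/2 * dx (dx (u 1)) q * dt 2 (v 1) q
    \<and> 1/3 * dt 3 (dx (v 1)) q =
        1/4 * dt 2 (dt 2 (v 1)) q + u 1 q * dx (dx (v 1)) q
        + 1/2 * dx (v 1) q * dt 2 (dx (v 1)) q - 1/2 * dx (dx (v 1)) q * dt 2 (v 1) q"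
proof
  fix q assume q: "q \<in> D"
  obtain x t where xt: "q = (x, t)" by (cases q)
  note dom = assms(1)
  have smooth: "smooth_on D (u 1)" "smooth_on D (u 2)" "smooth_on D (v 1)" "smooth_on D (v 2)"
    using assms(2,3) by auto
  have D: "D \<subseteq> (\<Union>N. slice N)"
    using dom by (simp add: is_domain_def)
  note commute = dx_dt_commute[OF dom _ q]
  have u1t: "dt 3 (u 1) r = 3/2 * dt 2 (u 2) r + 3 * (u 1 r * dx (u 1) r)
      - 3/2 * (dt 2 (v 1) r * dx (u 1) r)"
    if "r \<in> D" for r
    using D assms(2,3,6) that by (rule u_flow_3)
  have v1t: "dt 3 (v 1) r = 3/2 * dt 2 (v 2) r + 3 * (u 1 r * dx (v 1) r)
      - 3/2 * (dx (v 1) r * dt 2 (v 1) r) - 3 * u 2 r"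
    if "r \<in> D" for r
    using D assms(2,3,6) that by (rule v_flow_3)
  have u1y: "dt 2 (u 1) r = 2 * dx (u 2) r - 2 * (dx (v 1) r * dx (u 1) r)"
    if "r \<in> D" for r
    using D assms(2,3,6) that by (rule u_flow_2)
  have v1y: "dt 2 (v 1) r = 2 * dx (v 2) r - 2 * (dx (v 1) r * dx (v 1) r) - 2 * u 1 r"
    if "r \<in> D" for r
    using D assms(2,3,6) that by (rule v_flow_2)
  have uux: "dx (\<lambda>r. u 1 r * dx (u 1) r) q = dx (u 1) q * dx (u 1) q + dx (dx (u 1)) q * u 1 q"
    unfolding xt using q[unfolded xt] smooth
    by (intro dx_eqI[OF dom _ refl] DERIV_mult smooth_on_DERIV_x smooth_on_dx)
       auto
  have u1tx: "dx (dt 3 (u 1)) q = 3/2 * dx (dt 2 (u 2)) q + 3 * (dx (u 1) q * dx (u 1) q + dx (dx (u 1)) q * u 1 q)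
      - 3/2 * (dx (dt 2 (v 1)) q * dx (u 1) q + dx (dx (u 1)) q * dt 2 (v 1) q)"
    unfolding xt using q[unfolded xt] smooth
    by (intro dx_eqI[OF dom _ u1t] DERIV_diff DERIV_add DERIV_cmult DERIV_mult smooth_on_DERIV_x
        smooth_on_dx smooth_on_dt) auto
  have v1tx: "dx (dt 3 (v 1)) q = 3/2 * dx (dt 2 (v 2)) q + 3 * (dx (u 1) q * dx (v 1) q + dx (dx (v 1)) q * u 1 q)
      - 3/2 * (dx (dx (v 1)) q * dt 2 (v 1) q + dx (dt 2 (v 1)) q * dx (v 1) q) - 3 * dx (u 2) q"
    unfolding xt using q[unfolded xt] smooth
    by (intro dx_eqI[OF dom _ v1t] DERIV_diff DERIV_add DERIV_cmult DERIV_mult smooth_on_DERIV_x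
        smooth_on_dx smooth_on_dt) auto
  \<comment> \<open>The points \<open>(x, t(2 := t 2))\<close> are where the product rule evaluates
    the undifferentiated factors.\<close>
  have "dt 2 (dt 2 (u 1)) (x, t) = 2 * dt 2 (dx (u 2)) (x, t)
      - 2 * (dt 2 (dx (v 1)) (x, t) * dx (u 1) (x, t(2 := t 2))
             + dt 2 (dx (u 1)) (x, t) * dx (v 1) (x, t(2 := t 2)))"
    using q[unfolded xt] smooth
    by (intro dt_eqI[OF dom _ _ u1y] DERIV_diff DERIV_cmult DERIV_mult smooth_on_DERIV_t
        smooth_on_dx) auto
  then have u1yy: "dt 2 (dt 2 (u 1)) q = 2 * dt 2 (dx (u 2)) q
      - 2 * (dt 2 (dx (v 1)) q * dx (u 1) q + dt 2 (dx (u 1)) q * dx (v 1) q)"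
    by (simp only: xt fun_upd_triv)
  have "dt 2 (dt 2 (v 1)) (x, t) = 2 * dt 2 (dx (v 2)) (x, t)
      - 2 * (dt 2 (dx (v 1)) (x, t) * dx (v 1) (x, t(2 := t 2))
             + dt 2 (dx (v 1)) (x, t) * dx (v 1) (x, t(2 := t 2))) - 2 * dt 2 (u 1) (x, t)"
    using q[unfolded xt] smooth
    by (intro dt_eqI[OF dom _ _ v1y] DERIV_diff DERIV_cmult DERIV_mult smooth_on_DERIV_t
        smooth_on_dx) auto
  then have v1yy: "dt 2 (dt 2 (v 1)) q = 2 * dt 2 (dx (v 2)) q
      - 2 * (dt 2 (dx (v 1)) q * dx (v 1) q + dt 2 (dx (v 1)) q * dx (v 1) q) - 2 * dt 2 (u 1) q"
    by (simp only: xt fun_upd_triv)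
  note commutes = commute[OF smooth(1), of 3] commute[OF smooth(3), of 3]
    commute[OF smooth(2), of 2] commute[OF smooth(3), of 2] commute[OF smooth(4), of 2]
  \<comment> \<open>Both \<open>u1tx / 3\<close> and \<open>u1yy / 4\<close> contain half the mixed
    derivative of \<open>u 2\<close>, which drops out.\<close>
  have "1/3 * dt 3 (dx (u 1)) q =
        1/4 * dt 2 (dt 2 (u 1)) q + dx (\<lambda>r. u 1 r * dx (u 1) r) q
        + 1/2 * dx (v 1) q * dt 2 (dx (u 1)) q - 1/2 * dx (dx (u 1)) q * dt 2 (v 1) q"
    using u1tx u1yy commutes unfolding uux by (simp add: field_simps)
  moreover have "1/3 * dt 3 (dx (v 1)) q =
        1/4 * dt 2 (dt 2 (v 1)) q + u 1 q * dx (dx (v 1)) q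
        + 1/2 * dx (v 1) q * dt 2 (dx (v 1)) q - 1/2 * dx (dx (v 1)) q * dt 2 (v 1) q"
    \<comment> \<open>The mixed derivative of \<open>v 2\<close> drops out likewise;
      \<open>u1y\<close> reconciles \<open>dx (u 2)\<close> in \<open>v1tx\<close> with
      \<open>dt 2 (u 1)\<close> in \<open>v1yy\<close>.\<close>
    using v1tx v1yy commutes u1y[OF q] by (simp add: field_simps)
  ultimately show "1/3 * dt 3 (dx (u 1)) q =
        1/4 * dt 2 (dt 2 (u 1)) q + dx (\<lambda>r. u 1 r * dx (u 1) r) q
        + 1/2 * dx (v 1) q * dt 2 (dx (u 1)) q - 1/2 * dx (dx (u 1)) q * dt 2 (v 1) q
    \<and> 1/3 * dt 3 (dx (v 1)) q =
        1/4 * dt 2 (dt 2 (v 1)) q + u 1 q * dx (dx (v 1)) q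
        + 1/2 * dx (v 1) q * dt 2 (dx (v 1)) q - 1/2 * dx (dx (v 1)) q * dt 2 (v 1) q" ..
qed

end
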